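(* Suppose $\alpha_1<1/2$, let $\gamma=1-2\alpha_1>0$ and $\rho>\rho_c$. Then for $\lambda>0$, $$\lim_{V\to\infty}\Big\langle\exp\Big\{\lambda V^\gamma\Big(\frac{N_1}{V}-\Big\langle\frac{N_1}{V}\Big\rangle^C_V(\rho)\Big)\Big\}\Big\rangle^C_V(\rho)=\begin{cases}\exp(g_1(\lambda)),&\alpha_3<\alpha_2<\alpha_1<1/2,\\ \exp(2g_1(\lambda)+g_2(\lambda)),&\alpha_3<\alpha_2=\alpha_1<1/2,\\ \exp(3g_1(\lambda)+3g_2(\lambda)+g_3(\lambda)),&\alpha_3=\alpha_2=\alpha_1=1/3,\end{cases}$$ where, with $h_\lambda(\eta)=-\ln\big(1+\frac{\lambda}{\beta\eta}\big)+\frac{\lambda}{\beta\eta}$ and $e(m)=\frac{\pi^2}{2}(m^2-1)$, $g_1(\lambda)=\sum_{m\ge2}h_\lambda(e(m))$, $g_2(\lambda)=\sum_{m_1,m_2\ge2}h_\lambda(e(m_1)+e(m_2))$, $g_3(\lambda)=\sum_{m_1,m_2,m_3\ge2}h_\lambda(e(m_1)+e(m_2)+e(m_3))$.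
   Context: Fix exponents $\alpha_1\ge\alpha_2\ge\alpha_3>0$ with $\alpha_1+\alpha_2+\alpha_3=1$ and $\Lambda_V=\{x\in\mathbb{R}^3:0\le x_j\le V^{\alpha_j}\}$. The one-particle Hamiltonian $-\Delta/2$ on $L^2(\Lambda_V)$ with Dirichlet boundary conditions has eigenvalues $\frac{\pi^2}{2}\sum_jn_j^2V^{-2\alpha_j}$, $n_j\ge1$; $N_1$ is the occupation number of the ground state $\mathbf{n}=(1,1,1)$. Perfect Bose gas at inverse temperature $\beta>0$; canonical state at density $\rho=N/V$: $\langle\cdot\rangle^C_V(\rho)=Z_V(N)^{-1}\mathrm{Tr}(\cdot\,e^{-\beta T_V^{(N)}})$ on the symmetric $N$-particle space; limit at fixed $\rho$: $N$ particles in volume $V=N/\rho$, $N\to\infty$. $F(\eta)=\frac{\sqrt2}{3\pi^2}\eta^{3/2}$, $\rho_c=\int_0^\infty(e^{\beta\eta}-1)^{-1}F(d\eta)$. *)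

theory Defs
  imports "HOL-Analysis.Analysis"
begin

text \<open>Single-particle Dirichlet eigenvalues in the box with sides V powr a1, V powr a2, V powr a3,
  indexed by modes (n1,n2,n3) with all n_j >= 1.\<close>

definition modes :: "(nat \<times> nat \<times> nat) set" where
  "modes = {(n1, n2, n3). 1 \<le> n1 \<and> 1 \<le> n2 \<and> 1 \<le> n3}"

definition eigval :: "real \<Rightarrow> real \<Rightarrow> real \<Rightarrow> real \<Rightarrow> nat \<times> nat \<times> nat \<Rightarrow> real" where
  "eigval a1 a2 a3 V k = (case k of (n1, n2, n3) \<Rightarrow>
     pi^2 / 2 * (real n1 ^ 2 * V powr (-2 * a1) + real n2 ^ 2 * V powr (-2 * a2)
                 + real n3 ^ 2 * V powr (-2 * a3)))"

text \<open>Occupation-number configurations of N bosons (basis of the symmetric N-particle space).\<close>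

definition configs :: "nat \<Rightarrow> (nat \<times> nat \<times> nat \<Rightarrow> nat) set" where
  "configs N = {c. (\<forall>k. k \<notin> modes \<longrightarrow> c k = 0) \<and> finite {k. c k \<noteq> 0}
                   \<and> (\<Sum>k\<in>{k. c k \<noteq> 0}. c k) = N}"

definition energy :: "real \<Rightarrow> real \<Rightarrow> real \<Rightarrow> real \<Rightarrow> (nat \<times> nat \<times> nat \<Rightarrow> nat) \<Rightarrow> real" where
  "energy a1 a2 a3 V c = (\<Sum>k\<in>{k. c k \<noteq> 0}. real (c k) * eigval a1 a2 a3 V k)"

definition gibbs_weight :: "real \<Rightarrow> real \<Rightarrow> real \<Rightarrow> real \<Rightarrow> real \<Rightarrow> (nat \<times> nat \<times> nat \<Rightarrow> nat) \<Rightarrow> real" where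
  "gibbs_weight \<beta> a1 a2 a3 V c = exp (- \<beta> * energy a1 a2 a3 V c)"

text \<open>Canonical partition function Z_V(N) = Tr exp(-beta T) on the symmetric N-particle space.\<close>

definition canon_Z :: "real \<Rightarrow> real \<Rightarrow> real \<Rightarrow> real \<Rightarrow> real \<Rightarrow> nat \<Rightarrow> real" where
  "canon_Z \<beta> a1 a2 a3 V N = (\<Sum>\<^sub>\<infinity>c\<in>configs N. gibbs_weight \<beta> a1 a2 a3 V c)"

text \<open>Canonical expectation of an observable diagonal in the occupation-number basis.\<close>

definition canon_exp ::
  "real \<Rightarrow> real \<Rightarrow> real \<Rightarrow> real \<Rightarrow> real \<Rightarrow> nat \<Rightarrow> ((nat \<times> nat \<times> nat \<Rightarrow> nat) \<Rightarrow> real) \<Rightarrow> real" where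
  "canon_exp \<beta> a1 a2 a3 V N f =
     (\<Sum>\<^sub>\<infinity>c\<in>configs N. f c * gibbs_weight \<beta> a1 a2 a3 V c) / canon_Z \<beta> a1 a2 a3 V N"

definition occ_ground :: "(nat \<times> nat \<times> nat \<Rightarrow> nat) \<Rightarrow> nat" where
  "occ_ground c = c (1, 1, 1)"

definition Fdos :: "real \<Rightarrow> real" where
  "Fdos \<eta> = (if \<eta> \<le> 0 then 0 else sqrt 2 / (3 * pi^2) * \<eta> powr (3/2))"

definition rho_c :: "real \<Rightarrow> real" where
  "rho_c \<beta> = (LINT \<eta>:{0<..}|interval_measure Fdos. 1 / (exp (\<beta> * \<eta>) - 1))"

definition h_fun :: "real \<Rightarrow> real \<Rightarrow> real \<Rightarrow> real" where
  "h_fun \<beta> lam \<eta> = - ln (1 + lam / (\<beta> * \<eta>)) + lam / (\<beta> * \<eta>)"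

definition e_fun :: "nat \<Rightarrow> real" where
  "e_fun m = pi^2 / 2 * (real m ^ 2 - 1)"

definition g1 :: "real \<Rightarrow> real \<Rightarrow> real" where
  "g1 \<beta> lam = (\<Sum>\<^sub>\<infinity>m\<in>{2..}. h_fun \<beta> lam (e_fun m))"

definition g2 :: "real \<Rightarrow> real \<Rightarrow> real" where
  "g2 \<beta> lam = (\<Sum>\<^sub>\<infinity>(m1, m2)\<in>{2..} \<times> {2..}. h_fun \<beta> lam (e_fun m1 + e_fun m2))"

definition g3 :: "real \<Rightarrow> real \<Rightarrow> real" where
  "g3 \<beta> lam = (\<Sum>\<^sub>\<infinity>(m1, m2, m3)\<in>{2..} \<times> {2..} \<times> {2..}.
                 h_fun \<beta> lam (e_fun m1 + e_fun m2 + e_fun m3))"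

end

theory Submission
  imports Defs "HOL-Real_Asymp.Real_Asymp"
begin

text \<open>
  Put \<open>M = N - N\<^sub>1\<close>, the number of particles outside the ground state. Measuring energies from the ground
  state, the canonical law of the excited occupation numbers is a product of independent geometric
  laws with means \<open>n\<^sub>k = 1 / (exp (\<beta> \<epsilon>\<^sub>k) - 1)\<close>, conditioned on \<open>M \<le> N\<close>. Without the conditioning, the
  Laplace transform of \<open>M - m\<close>, \<open>m = \<Sum>k. n\<^sub>k\<close>, at \<open>s = \<lambda> V\<^bsup>-2\<alpha>\<^sub>1\<^esup>\<close> is the exponential of
  \<open>\<Sum>k. s n\<^sub>k - ln (1 + (1 - exp (-s)) n\<^sub>k)\<close>. Each term is \<open>O((V\<^bsup>2\<alpha>\<^sub>1\<^esup> \<epsilon>\<^sub>k)\<^bsup>-2\<^esup>)\<close>, which is dominated by the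
  summable \<open>(n\<^sub>1 n\<^sub>2 n\<^sub>3)\<^bsup>-4/3\<^esup>\<close>, and converges to \<open>h\<^sub>\<lambda>\<close> or to 0 according to whether
  \<open>V\<^bsup>2\<alpha>\<^sub>1\<^esup> \<epsilon>\<^sub>k\<close> stays constant or diverges. The same bound for small \<open>s\<close> of either sign shows that
  \<open>V\<^bsup>-2\<alpha>\<^sub>1\<^esup> (M - m)\<close> is centred with bounded variance. Comparing the sum \<open>m\<close> with an integral gives
  \<open>m \<le> V \<rho>\<^sub>c + o(V)\<close>, so for \<open>\<rho> > \<rho>\<^sub>c\<close> the event \<open>M > N\<close> lies at distance of order \<open>V\<^bsup>1-2\<alpha>\<^sub>1\<^esup>\<close> in the
  rescaled variable, and conditioning changes nothing in the limit.
\<close>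

section \<open>Bose occupation numbers and geometric cumulants\<close>

definition nbar :: "real \<Rightarrow> real" where "nbar x = 1 / (exp x - 1)"

lemma nbar_nonneg: "0 \<le> x \<Longrightarrow> 0 \<le> nbar x"
  by (simp add: nbar_def)

lemma exp_ge_quadratic: "0 \<le> x \<Longrightarrow> 1 + x + x\<^sup>2 / 2 \<le> exp (x::real)"
  using exp_lower_Taylor_quadratic by blast

lemma nbar_antimono: "0 < x \<Longrightarrow> x \<le> y \<Longrightarrow> nbar y \<le> nbar x"
  unfolding nbar_def by (intro divide_left_mono mult_pos_pos) auto

lemma nbar_le_inverse: assumes "0 < x" shows "nbar x \<le> 1 / x"
proof -
  have "x \<le> exp x - 1" using exp_ge_add_one_self[of x] by linarith
  then show ?thesis unfolding nbar_def using assms by (intro divide_left_mono mult_pos_pos) auto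
qed

text \<open>For \<open>x \<le> 1\<close> the linear term of exp dominates \<open>x powr p\<close>,
  for \<open>x > 1\<close> the quadratic one does. The exponent stays free because modes with some
  index 1 will need a p just above 1: p = 1 is not summable and p = 2 costs too many powers of
  V.\<close>

lemma nbar_le_powr:
  assumes "0 < x" "1 \<le> p" "p \<le> 2"
  shows "nbar x \<le> 2 * x powr (- p)"
proof -
  have "x powr p \<le> 2 * (exp x - 1)"
  proof (cases "x \<le> 1")
    case True
    then have "x powr p \<le> x powr 1" using assms by (intro powr_mono') auto
    also have "\<dots> = x" using assms by simp
    also have "\<dots> \<le> 2 * (exp x - 1)" using assms(1) exp_ge_quadratic[OF less_imp_le[OF assms(1)]] zero_le_power2[of x] by argo
    finally show ?thesis .
  next
    case False
    then have "x powr p \<le> x powr 2" using assms by (intro powr_mono) auto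
    also have "\<dots> = x\<^sup>2" using assms by (simp add: powr_numeral)
    also have "\<dots> \<le> 2 * (exp x - 1)" using exp_ge_quadratic[of x] assms by auto
    finally show ?thesis .
  qed
  then show ?thesis using assms
    by (simp add: nbar_def powr_minus field_simps)
qed

lemma nbar_le_square: assumes "0 < x" shows "nbar x \<le> 2 / x\<^sup>2"
  using nbar_le_powr[of x 2] assms by (simp add: powr_minus powr_numeral field_simps)

text \<open>A geometric variable X of mean n has Laplace transform
  \<open>1 / (1 + (1 - exp (- s)) * n)\<close>, so this is the logarithm of the Laplace transform of
  X - n at s.\<close>

definition cumul :: "real \<Rightarrow> real \<Rightarrow> real" where
  "cumul s n = s * n - ln (1 + (1 - exp (- s)) * n)"

lemma one_minus_exp_le: "1 - exp (- s) \<le> (s::real)"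
  using exp_ge_add_one_self[of "-s"] by simp

lemma cumul_nonneg:
  assumes "0 \<le> n" "0 < 1 + (1 - exp (- s)) * n"
  shows "0 \<le> cumul s n"
proof -
  have "ln (1 + (1 - exp (- s)) * n) \<le> (1 - exp (- s)) * n"
    using ln_le_minus_one[OF assms(2)] by simp
  also have "\<dots> \<le> s * n" using one_minus_exp_le assms(1) by (intro mult_right_mono)
  finally show ?thesis by (simp add: cumul_def)
qed

text \<open>Centring cancels the terms of first order in s. What remains after two Taylor bounds
  valid on the whole half-line is s^2 / 2 times the geometric variance n + n^2.\<close>

lemma cumul_le:
  assumes "0 \<le> n" "0 \<le> s"
  shows "cumul s n \<le> s\<^sup>2 * n / 2 + s\<^sup>2 * n\<^sup>2 / 2"
proof -
  define y where "y = (1 - exp (- s)) * n"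
  have y0: "0 \<le> y" using assms by (auto simp: y_def)
  have ysn: "y \<le> s * n" using one_minus_exp_le assms(1) by (auto simp: y_def intro!: mult_right_mono)
  have 1: "y - y\<^sup>2 / 2 \<le> ln (1 + y)"
  proof -
    have "((\<lambda>y. ln (1 + y) - y + y\<^sup>2 / 2) has_real_derivative (1 / (1 + t) - 1 + t)) (at t)"
      if "0 \<le> t" for t
      using that by (auto intro!: derivative_eq_intros simp: field_simps power2_eq_square)
    then have "ln (1 + 0) - 0 + 0\<^sup>2 / 2 \<le> ln (1 + y) - y + y\<^sup>2 / 2"
    proof (intro DERIV_nonneg_imp_nondecreasing[OF y0])
      fix x assume "0 \<le> x" "x \<le> y"
      moreover have "0 \<le> 1 / (1 + x) - 1 + x" using \<open>0 \<le> x\<close> by (simp add: field_simps)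
      ultimately show "\<exists>z. ((\<lambda>y. ln (1 + y) - y + y\<^sup>2 / 2) has_real_derivative z) (at x) \<and> 0 \<le> z"
        using \<open>\<And>t. 0 \<le> t \<Longrightarrow> _\<close> by blast
    qed
    then show ?thesis by simp
  qed
  have 2: "exp (- s) \<le> 1 - s + s\<^sup>2 / 2"
  proof -
    have d: "((\<lambda>s. 1 - s + s\<^sup>2 / 2 - exp (- s)) has_real_derivative (- 1 + t + exp (- t))) (at t)" for t :: real
      by (auto intro!: derivative_eq_intros)
    have "1 - 0 + 0\<^sup>2 / 2 - exp (- 0) \<le> 1 - s + s\<^sup>2 / 2 - exp (- s)"
    proof (intro DERIV_nonneg_imp_nondecreasing[OF assms(2)])
      fix x :: real
      have "0 \<le> - 1 + x + exp (- x)" using one_minus_exp_le[of x] by simp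
      then show "\<exists>z. ((\<lambda>s. 1 - s + s\<^sup>2 / 2 - exp (- s)) has_real_derivative z) (at x) \<and> 0 \<le> z"
        using d by blast
    qed
    then show ?thesis by simp
  qed
  have "cumul s n \<le> s * n - y + y\<^sup>2 / 2" using 1 by (simp add: cumul_def y_def)
  also have "s * n - y = (s - 1 + exp (- s)) * n" by (simp add: y_def algebra_simps)
  also have "\<dots> \<le> s\<^sup>2 / 2 * n" using 2 assms by (intro mult_right_mono) auto
  also have "y\<^sup>2 \<le> (s * n)\<^sup>2" using y0 ysn by (intro power_mono)
  finally show ?thesis by (simp add: power_mult_distrib)
qed

lemma abs_exp_minus_one_le:
  assumes "\<bar>s\<bar> \<le> (1::real)" shows "\<bar>1 - exp (- s)\<bar> \<le> 2 * \<bar>s\<bar>" "exp (- s) \<le> 1 - s + s\<^sup>2"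
proof -
  show b: "exp (- s) \<le> 1 - s + s\<^sup>2"
  proof (cases "s \<le> 0")
    case True then show ?thesis using exp_bound[of "-s"] assms by auto
  next
    case False
    have "exp (- s) = 1 / exp s" by (simp add: exp_minus field_simps)
    also have "\<dots> \<le> 1 / (1 + s)" using False exp_ge_add_one_self[of s]
      by (intro divide_left_mono mult_pos_pos) auto
    also have "\<dots> \<le> 1 - s + s\<^sup>2"
    proof -
      have "1 \<le> (1 - s + s\<^sup>2) * (1 + s)" using False by (simp add: algebra_simps power2_eq_square)
      then show ?thesis using False by (simp add: divide_le_eq)
    qed
    finally show ?thesis .
  qed
  have "s\<^sup>2 \<le> \<bar>s\<bar>" using assms
    by (metis abs_ge_zero abs_mult mult_left_le power2_abs power2_eq_square)
  then show "\<bar>1 - exp (- s)\<bar> \<le> 2 * \<bar>s\<bar>" using b one_minus_exp_le[of s] by auto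
qed

text \<open>Both signs of s are needed to identify the mean. For negative s positivity of the
  argument of ln is the convergence condition of the transform. The bound 1/4 keeps
  \<open>y = (1 - exp (- s)) * n\<close> in [-1/2, 1/2], where \<open>ln (1 + y)\<close> differs
  from y by at most 2 y^2.\<close>

lemma cumul_le_small:
  assumes "0 \<le> n" "\<bar>s\<bar> \<le> 1" "\<bar>s\<bar> * n \<le> 1/4"
  shows "0 < 1 + (1 - exp (- s)) * n" "cumul s n \<le> s\<^sup>2 * n + 8 * (s\<^sup>2 * n\<^sup>2)"
proof -
  define y where "y = (1 - exp (- s)) * n"
  have ya: "\<bar>y\<bar> \<le> 2 * (\<bar>s\<bar> * n)"
    unfolding y_def abs_mult using abs_exp_minus_one_le(1)[OF assms(2)] assms(1) mult_right_mono
    by fastforce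
  then have yh: "\<bar>y\<bar> \<le> 1/2" using assms by auto
  then show "0 < 1 + (1 - exp (- s)) * n" by (simp add: y_def)
  have 1: "y - 2 * y\<^sup>2 \<le> ln (1 + y)" using abs_ln_one_plus_x_minus_x_bound[OF yh] by auto
  have "cumul s n \<le> s * n - y + 2 * y\<^sup>2" using 1 by (simp add: cumul_def y_def)
  also have "s * n - y = (s - 1 + exp (- s)) * n" by (simp add: y_def algebra_simps)
  also have "\<dots> \<le> s\<^sup>2 * n" using abs_exp_minus_one_le(2)[OF assms(2)] assms by (intro mult_right_mono) auto
  also have "y\<^sup>2 \<le> (2 * (\<bar>s\<bar> * n))\<^sup>2" using ya by (metis abs_ge_zero power2_abs power_mono)
  finally show "cumul s n \<le> s\<^sup>2 * n + 8 * (s\<^sup>2 * n\<^sup>2)" by (simp add: power_mult_distrib)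
qed

section \<open>Independent geometric occupation numbers\<close>

definition fin_supp :: "'a set \<Rightarrow> ('a \<Rightarrow> nat) set" where
  "fin_supp K = {c. (\<forall>k. k \<notin> K \<longrightarrow> c k = 0) \<and> finite {k. c k \<noteq> 0}}"

definition particles :: "('a \<Rightarrow> nat) \<Rightarrow> nat" where
  "particles c = (\<Sum>k | c k \<noteq> 0. c k)"

definition weight :: "('a \<Rightarrow> real) \<Rightarrow> ('a \<Rightarrow> nat) \<Rightarrow> real" where
  "weight x c = (\<Prod>k | c k \<noteq> 0. x k ^ c k)"

lemma fin_supp_mono: "A \<subseteq> B \<Longrightarrow> fin_supp A \<subseteq> fin_supp B"
  by (auto simp: fin_supp_def)

lemma weight_eq_prod:
  assumes "finite A" "c \<in> fin_supp A"
  shows "weight x c = (\<Prod>k\<in>A. x k ^ c k)"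
  unfolding weight_def using assms by (intro prod.mono_neutral_left) (auto simp: fin_supp_def)

lemma weight_nonneg: "(\<And>k. k \<in> K \<Longrightarrow> 0 \<le> x k) \<Longrightarrow> c \<in> fin_supp K \<Longrightarrow> 0 \<le> weight x c"
  unfolding weight_def by (intro prod_nonneg ballI zero_le_power) (force simp: fin_supp_def)

text \<open>A factor exponential in the particle number is absorbed into the one-mode parameters, so
  the Laplace transform of the particle number is again a sum of weights.\<close>

lemma weight_scale: "weight (\<lambda>k. x k * t) c = weight x c * t ^ particles c"
  by (simp add: weight_def particles_def power_mult_distrib prod.distrib power_sum)

text \<open>Induction over the modes: each new mode contributes one geometric series, and summation
  over the product set multiplies the values, all terms being nonnegative.\<close>

lemma weight_has_sum_finite:
  assumes "finite A" "\<And>k. k \<in> A \<Longrightarrow> 0 \<le> x k \<and> x k < 1"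
  shows "(weight x has_sum (\<Prod>k\<in>A. 1 / (1 - x k))) (fin_supp A)"
  using assms
proof (induction A rule: finite_induct)
  case empty
  have "fin_supp {} = {\<lambda>_::'a. 0}" by (auto simp: fin_supp_def)
  moreover have "weight x (\<lambda>_. 0) = 1" by (simp add: weight_def)
  ultimately show ?case by (auto intro: has_sum_finiteI)
next
  case (insert a A)
  \<comment> \<open>Members of \<open>fin_supp A\<close> vanish at a, so setting the value at a
    loses nothing and resetting it to 0 is the inverse.\<close>
  have bij: "bij_betw (\<lambda>(n, c). c(a := n)) (UNIV \<times> fin_supp A) (fin_supp (insert a A))"
  proof (rule bij_betwI[where g = "\<lambda>c. (c a, c(a := 0))"])
    show "(\<lambda>(n, c). c(a := n)) \<in> UNIV \<times> fin_supp A \<rightarrow> fin_supp (insert a A)"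
      using insert.hyps(1) by (auto simp: fin_supp_def intro!: finite_subset[of _ "insert a A"] split: if_splits)
    show "(\<lambda>c. (c a, c(a := 0))) \<in> fin_supp (insert a A) \<rightarrow> UNIV \<times> fin_supp A"
      using insert.hyps(1) by (auto simp: fin_supp_def intro!: finite_subset[of _ A] split: if_splits)
  qed (use insert.hyps(2) in \<open>auto simp: fin_supp_def\<close>)
  have w: "weight x (c(a := n)) = x a ^ n * weight x c" if c: "c \<in> fin_supp A" for n c
  proof -
    have "c(a := n) \<in> fin_supp (insert a A)" using bij_betw_apply[OF bij, of "(n, c)"] c by simp
    then have "weight x (c(a := n)) = (\<Prod>k\<in>insert a A. x k ^ (c(a := n)) k)"
      using insert.hyps(1) by (intro weight_eq_prod) auto
    also have "\<dots> = x a ^ n * (\<Prod>k\<in>A. x k ^ (c(a := n)) k)" using insert.hyps by simp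
    also have "(\<Prod>k\<in>A. x k ^ (c(a := n)) k) = weight x c"
      unfolding weight_eq_prod[OF insert.hyps(1) c] using insert.hyps by (intro prod.cong) auto
    finally show ?thesis .
  qed
  have xa: "0 \<le> x a" "x a < 1" using insert.prems by auto
  have geo: "((\<lambda>n. x a ^ n) has_sum (1 / (1 - x a))) UNIV"
    using geometric_sums[of "x a"] xa by (intro sums_nonneg_imp_has_sum) auto
  have IH: "(weight x has_sum (\<Prod>k\<in>A. 1 / (1 - x k))) (fin_supp A)" using insert by auto
  have "((\<lambda>(n, c). x a ^ n * weight x c) has_sum (1 / (1 - x a) * (\<Prod>k\<in>A. 1 / (1 - x k)))) (UNIV \<times> fin_supp A)"
  proof (rule has_sum_SigmaI)
    show "((\<lambda>c. case (n, c) of (n, c) \<Rightarrow> x a ^ n * weight x c) has_sum x a ^ n * (\<Prod>k\<in>A. 1 / (1 - x k))) (fin_supp A)" for n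
      using has_sum_cmult_right[OF IH] by simp
    show "((\<lambda>n. x a ^ n * (\<Prod>k\<in>A. 1 / (1 - x k))) has_sum 1 / (1 - x a) * (\<Prod>k\<in>A. 1 / (1 - x k))) UNIV"
      by (rule has_sum_cmult_left[OF geo])
    show "(\<lambda>(n, c). x a ^ n * weight x c) summable_on UNIV \<times> fin_supp A"
    proof (rule summable_on_SigmaI)
      show "((\<lambda>c. case (n, c) of (n, c) \<Rightarrow> x a ^ n * weight x c) has_sum x a ^ n * (\<Prod>k\<in>A. 1 / (1 - x k))) (fin_supp A)" for n
        using has_sum_cmult_right[OF IH] by simp
      show "(\<lambda>n. x a ^ n * (\<Prod>k\<in>A. 1 / (1 - x k))) summable_on UNIV"
        using has_sum_cmult_left[OF geo] by (rule has_sum_imp_summable)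
      show "0 \<le> (case (n, c) of (n, c) \<Rightarrow> x a ^ n * weight x c)" if "c \<in> fin_supp A" for n c
        using xa insert.prems weight_nonneg[of A x c] that by auto
    qed
  qed
  then have "((\<lambda>p. weight x ((\<lambda>(n, c). c(a := n)) p)) has_sum (1 / (1 - x a) * (\<Prod>k\<in>A. 1 / (1 - x k)))) (UNIV \<times> fin_supp A)"
    by (rule has_sum_cong[THEN iffD1, rotated]) (auto simp: w)
  then show ?case using insert.hyps has_sum_reindex_bij_betw[OF bij, of "weight x"] by simp
qed

text \<open>Exhaustion by finite sets of modes. Finitely many configurations occupy finitely many
  modes, which bounds every partial sum from above; conversely each finite product is a subsum, and
  taking logarithms bounds the finite sums of \<open>- ln (1 - x k)\<close>.\<close>

lemma weight_has_sum:
  assumes x: "\<And>k. k \<in> K \<Longrightarrow> 0 \<le> x k \<and> x k < 1"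
    and s: "(\<lambda>k. - ln (1 - x k)) summable_on K"
  shows "(weight x has_sum exp (\<Sum>\<^sub>\<infinity>k\<in>K. - ln (1 - x k))) (fin_supp K)"
proof -
  define l where "l k = - ln (1 - x k)" for k
  have l0: "0 \<le> l k" if "k \<in> K" for k using x[OF that] by (simp add: l_def)
  have fin: "(weight x has_sum exp (sum l A)) (fin_supp A)" if "finite A" "A \<subseteq> K" for A
  proof -
    have "exp (l k) = 1 / (1 - x k)" if "k \<in> A" for k
      using x[of k] that \<open>A \<subseteq> K\<close> by (auto simp: l_def exp_minus divide_inverse)
    then show ?thesis using weight_has_sum_finite[of A x] that x by (auto simp: exp_sum)
  qed
  have bd: "sum (weight x) F \<le> exp (infsum l K)" if F: "finite F" "F \<subseteq> fin_supp K" for F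
  proof -
    define A where "A = (\<Union>c\<in>F. {k. c k \<noteq> 0})"
    have A: "finite A" "A \<subseteq> K" and FA: "F \<subseteq> fin_supp A" using F by (force simp: A_def fin_supp_def)+
    have "sum (weight x) F \<le> exp (sum l A)"
    proof (rule has_sum_mono2)
      show "(weight x has_sum sum (weight x) F) F" using F by (simp add: has_sum_finite)
      show "(weight x has_sum exp (sum l A)) (fin_supp A)" by (rule fin[OF A])
    qed (use FA weight_nonneg[of K x] x fin_supp_mono[OF A(2)] in auto)
    also have "sum l A \<le> infsum l K"
      using s A l0 unfolding l_def[symmetric] by (intro finite_sum_le_infsum) auto
    finally show ?thesis by simp
  qed
  have nn: "0 \<le> weight x c" if "c \<in> fin_supp K" for c using weight_nonneg[of K x c] x that by auto
  have summ: "weight x summable_on fin_supp K"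
    using nn bd by (intro nonneg_bounded_partial_sums_imp_summable_on[where C = "exp (infsum l K)"])
      (auto simp: eventually_finite_subsets_at_top)
  have "infsum (weight x) (fin_supp K) \<le> exp (infsum l K)"
    using summ bd by (intro infsum_le_finite_sums) auto
  moreover have "exp (infsum l K) \<le> infsum (weight x) (fin_supp K)"
  proof -
    have *: "exp (sum l A) \<le> infsum (weight x) (fin_supp K)" if "finite A" "A \<subseteq> K" for A
      by (rule has_sum_mono2[OF fin[OF that] has_sum_infsum[OF summ] fin_supp_mono[OF that(2)]])
        (use nn in auto)
    have pos: "0 < infsum (weight x) (fin_supp K)"
      using *[of "{}"] by auto
    have "infsum l K \<le> ln (infsum (weight x) (fin_supp K))"
    proof (rule infsum_le_finite_sums)
      show "l summable_on K" using s by (simp add: l_def[abs_def])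
      show "sum l A \<le> ln (infsum (weight x) (fin_supp K))" if "finite A" "A \<subseteq> K" for A
        using *[OF that] pos by (subst ln_ge_iff) auto
    qed
    then show ?thesis using pos by (metis ln_ge_iff)
  qed
  ultimately have "infsum (weight x) (fin_supp K) = exp (infsum l K)" by simp
  then show ?thesis using has_sum_infsum[OF summ] by (simp add: l_def[abs_def])
qed

text \<open>Here \<open>weight q c / Z\<close> is the law of independent geometric variables with means \<open>n k\<close>.\<close>

lemma weight_laplace:
  assumes q: "\<And>k. k \<in> K \<Longrightarrow> 0 < q k \<and> q k < 1"
    and n: "\<And>k. k \<in> K \<Longrightarrow> n k = q k / (1 - q k)"
    and sn: "n summable_on K"
    and pos: "\<And>k. k \<in> K \<Longrightarrow> 0 < 1 + (1 - exp (- \<sigma>)) * n k"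
    and sc: "(\<lambda>k. cumul \<sigma> (n k)) summable_on K"
  defines "Z \<equiv> exp (\<Sum>\<^sub>\<infinity>k\<in>K. - ln (1 - q k))"
  shows "((\<lambda>c. weight q c / Z * exp (- \<sigma> * (real (particles c) - infsum n K))) has_sum
           exp (\<Sum>\<^sub>\<infinity>k\<in>K. cumul \<sigma> (n k))) (fin_supp K)"
proof -
  define t where "t = exp (- \<sigma>)"
  \<comment> \<open>Tilting replaces q by q t. Written through the mean n, the new factor separates
    into the old one and the argument of the logarithm in \<open>cumul\<close>; hence positivity of
    that argument is the same as q t < 1.\<close>
  have fac: "1 - q k * t = (1 - q k) * (1 + (1 - t) * n k)" if "k \<in> K" for k
  proof -
    have "(1 - q k) * n k = q k" using q[OF that] n[OF that] by simp
    then have "(1 - q k) * (1 + (1 - t) * n k) = 1 - q k + (1 - t) * q k"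
      by (metis distrib_left mult.left_commute mult.right_neutral)
    then show ?thesis by (simp add: algebra_simps)
  qed
  have x: "0 \<le> q k * t \<and> q k * t < 1" if "k \<in> K" for k
    using fac[OF that] q[OF that] pos[OF that]
    by (smt (verit) exp_gt_zero mult_nonneg_nonneg mult_pos_pos t_def)
  \<comment> \<open>Since 1 / (1 - q) = 1 + n, summability of the logarithms follows from that of
    the means by ln (1 + n) \<le> n.\<close>
  have lq: "(\<lambda>k. - ln (1 - q k)) summable_on K"
  proof (rule summable_on_comparison_test[OF sn])
    fix k assume k: "k \<in> K"
    have "- ln (1 - q k) = ln (1 / (1 - q k))" using q[OF k] by (simp add: ln_div)
    also have "1 / (1 - q k) = 1 + n k" using q[OF k] n[OF k] by (simp add: field_simps)
    also have "ln (1 + n k) \<le> n k" using n[OF k] q[OF k] by (intro ln_add_one_self_le_self) auto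
    finally show "- ln (1 - q k) \<le> n k" .
    show "0 \<le> - ln (1 - q k)" using q[OF k] by simp
  qed
  have eq: "- ln (1 - q k * t) = - ln (1 - q k) + (cumul \<sigma> (n k) + (- \<sigma>) * n k)" if "k \<in> K" for k
    using fac[OF that] q[OF that] pos[OF that] by (simp add: ln_mult cumul_def t_def)
  have "((\<lambda>k. - ln (1 - q k) + (cumul \<sigma> (n k) + (- \<sigma>) * n k)) has_sum
      (\<Sum>\<^sub>\<infinity>k\<in>K. - ln (1 - q k)) + ((\<Sum>\<^sub>\<infinity>k\<in>K. cumul \<sigma> (n k)) + (- \<sigma>) * infsum n K)) K"
    by (intro has_sum_add has_sum_cmult_right has_sum_infsum lq sc sn)
  then have hs: "((\<lambda>k. - ln (1 - q k * t)) has_sum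
      (\<Sum>\<^sub>\<infinity>k\<in>K. - ln (1 - q k)) + ((\<Sum>\<^sub>\<infinity>k\<in>K. cumul \<sigma> (n k)) + (- \<sigma>) * infsum n K)) K"
    by (rule has_sum_cong[THEN iffD1, rotated]) (simp add: eq)
  have "(weight (\<lambda>k. q k * t) has_sum exp (\<Sum>\<^sub>\<infinity>k\<in>K. - ln (1 - q k * t))) (fin_supp K)"
    by (rule weight_has_sum[OF x]) (use hs in \<open>auto intro: has_sum_imp_summable\<close>)
  also have "(\<Sum>\<^sub>\<infinity>k\<in>K. - ln (1 - q k * t)) =
      (\<Sum>\<^sub>\<infinity>k\<in>K. - ln (1 - q k)) + ((\<Sum>\<^sub>\<infinity>k\<in>K. cumul \<sigma> (n k)) + (- \<sigma>) * infsum n K)"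
    using hs by (rule infsumI)
  also have "exp \<dots> = Z * exp (\<Sum>\<^sub>\<infinity>k\<in>K. cumul \<sigma> (n k)) * exp (- \<sigma> * infsum n K)"
    by (simp add: Z_def exp_add exp_diff exp_minus field_simps)
  finally have "((\<lambda>c. weight (\<lambda>k. q k * t) c * (exp (\<sigma> * infsum n K) / Z)) has_sum
      Z * exp (\<Sum>\<^sub>\<infinity>k\<in>K. cumul \<sigma> (n k)) * exp (- \<sigma> * infsum n K) * (exp (\<sigma> * infsum n K) / Z)) (fin_supp K)"
    by (rule has_sum_cmult_left)
  also have "Z * exp (\<Sum>\<^sub>\<infinity>k\<in>K. cumul \<sigma> (n k)) * exp (- \<sigma> * infsum n K) * (exp (\<sigma> * infsum n K) / Z)
    = exp (\<Sum>\<^sub>\<infinity>k\<in>K. cumul \<sigma> (n k))" by (simp add: Z_def exp_minus field_simps)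
  also have "(\<lambda>c. weight (\<lambda>k. q k * t) c * (exp (\<sigma> * infsum n K) / Z))
    = (\<lambda>c. weight q c / Z * exp (- \<sigma> * (real (particles c) - infsum n K)))"
    unfolding weight_scale t_def exp_of_nat_mult[symmetric]
    by (simp add: right_diff_distrib exp_diff exp_minus field_simps fun_eq_iff)
  finally show ?thesis .
qed

section \<open>The canonical ensemble as a conditioned product law\<close>

definition excited :: "(nat \<times> nat \<times> nat) set" where
  "excited = modes - {(1, 1, 1)}"

definition gap :: "real \<Rightarrow> real \<Rightarrow> real \<Rightarrow> real \<Rightarrow> nat \<times> nat \<times> nat \<Rightarrow> real" where
  "gap a1 a2 a3 V k = eigval a1 a2 a3 V k - eigval a1 a2 a3 V (1, 1, 1)"

text \<open>For j = 0 the point a stays outside the support, which is why \<open>f a 0 = 0\<close>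
  is required.\<close>

lemma sum_support_upd:
  fixes c :: "'a \<Rightarrow> nat" and f :: "'a \<Rightarrow> nat \<Rightarrow> 'b::comm_monoid_add"
  assumes "finite {k. c k \<noteq> 0}" "c a = 0" "f a 0 = 0"
  shows "(\<Sum>k | (c(a := j)) k \<noteq> 0. f k ((c(a := j)) k)) = f a j + (\<Sum>k | c k \<noteq> 0. f k (c k))"
proof (cases "j = 0")
  case True
  then have "c(a := j) = c" using assms(2) by auto
  then show ?thesis using True assms(3) by simp
next
  case False
  then have "{k. (c(a := j)) k \<noteq> 0} = insert a {k. c k \<noteq> 0}" by auto
  moreover have "a \<notin> {k. c k \<noteq> 0}" using assms(2) by simp
  moreover have "(\<Sum>k | c k \<noteq> 0. f k ((c(a := j)) k)) = (\<Sum>k | c k \<noteq> 0. f k (c k))"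
    using assms(2) by (intro sum.cong) auto
  ultimately show ?thesis using assms(1) by simp
qed

text \<open>Fixing the total number determines the ground-state occupation from the excited ones, so
  the constraint of exactly N particles turns into the event of at most N excited ones.\<close>

lemma bij_configs:
  "bij_betw (\<lambda>c. c((1, 1, 1) := N - particles c)) {c \<in> fin_supp excited. particles c \<le> N} (configs N)"
proof (rule bij_betwI[where g = "\<lambda>c. c((1, 1, 1) := 0)"])
  let ?o = "(1, 1, 1) :: nat \<times> nat \<times> nat"
  have tot: "particles (c(?o := j)) = j + particles c" if "c \<in> fin_supp excited" for c j
    unfolding particles_def using sum_support_upd[of c ?o "\<lambda>_ x. x" j] that
    by (simp add: fin_supp_def excited_def)
  show "(\<lambda>c. c(?o := N - particles c)) \<in> {c \<in> fin_supp excited. particles c \<le> N} \<rightarrow> configs N"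
  proof
    fix c assume c: "c \<in> {c \<in> fin_supp excited. particles c \<le> N}"
    have "finite {k. (c(?o := N - particles c)) k \<noteq> 0}"
      by (rule finite_subset[of _ "insert ?o {k. c k \<noteq> 0}"])
        (use c in \<open>auto simp: fin_supp_def split: if_splits\<close>)
    moreover have "particles (c(?o := N - particles c)) = N" using tot c by simp
    moreover have "?o \<in> modes" by (simp add: modes_def)
    ultimately show "c(?o := N - particles c) \<in> configs N" using c
      by (auto simp: configs_def particles_def fin_supp_def excited_def)
  qed
  have up: "c(?o := 0) \<in> fin_supp excited" if "c \<in> configs N" for c
  proof -
    have "finite {k. (c(?o := 0)) k \<noteq> 0}"
      by (rule finite_subset[of _ "{k. c k \<noteq> 0}"])
        (use that in \<open>auto simp: configs_def split: if_splits\<close>)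
    moreover have "(c(?o := 0)) k = 0" if "k \<notin> excited" for k
    proof (cases "k = ?o")
      case False
      then have "k \<notin> modes" using that unfolding excited_def by blast
      then have "c k = 0" using \<open>c \<in> configs N\<close> unfolding configs_def by blast
      then show ?thesis by simp
    qed simp
    ultimately show ?thesis unfolding fin_supp_def by blast
  qed
  have tt: "c ?o + particles (c(?o := 0)) = N" if "c \<in> configs N" for c
    using tot[OF up[OF that], of "c ?o"] that by (simp add: configs_def particles_def)
  show "(\<lambda>c. c(?o := 0)) \<in> configs N \<rightarrow> {c \<in> fin_supp excited. particles c \<le> N}"
  proof
    fix c assume "c \<in> configs N"
    then show "c(?o := 0) \<in> {c \<in> fin_supp excited. particles c \<le> N}"
      using up tt[of c] by auto
  qed
  show "(c(?o := N - particles c))(?o := 0) = c" if "c \<in> {c \<in> fin_supp excited. particles c \<le> N}" for c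
    using that by (auto simp: fin_supp_def excited_def)
  show "(c(?o := 0))(?o := N - particles (c(?o := 0))) = c" if "c \<in> configs N" for c
  proof -
    have "N - particles (c(?o := 0)) = c ?o" using tt[OF that] by linarith
    then show ?thesis by simp
  qed
qed

text \<open>Each of the N particles carries at least the ground-state energy. Taking this constant
  out leaves a weight in the gaps alone, in which the ground state no longer appears.\<close>

lemma canon_sum:
  fixes \<beta> a1 a2 a3 V :: real
  defines "q \<equiv> \<lambda>k. exp (- \<beta> * gap a1 a2 a3 V k)"
  shows "(\<Sum>\<^sub>\<infinity>c\<in>configs N. g (occ_ground c) * gibbs_weight \<beta> a1 a2 a3 V c) =
     exp (- \<beta> * (real N * eigval a1 a2 a3 V (1, 1, 1))) *
       (\<Sum>\<^sub>\<infinity>c\<in>{c \<in> fin_supp excited. particles c \<le> N}. g (N - particles c) * weight q c)"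
proof -
  let ?o = "(1, 1, 1) :: nat \<times> nat \<times> nat" and ?E = "eigval a1 a2 a3 V"
  let ?A = "{c \<in> fin_supp excited. particles c \<le> N}"
  have "(\<Sum>\<^sub>\<infinity>c\<in>configs N. g (occ_ground c) * gibbs_weight \<beta> a1 a2 a3 V c) =
    (\<Sum>\<^sub>\<infinity>c\<in>?A. g (occ_ground (c(?o := N - particles c))) * gibbs_weight \<beta> a1 a2 a3 V (c(?o := N - particles c)))"
    by (rule infsum_reindex_bij_betw[OF bij_configs, symmetric])
  also have "\<dots> = (\<Sum>\<^sub>\<infinity>c\<in>?A. exp (- \<beta> * (real N * ?E ?o)) * (g (N - particles c) * weight q c))"
  proof (rule infsum_cong)
    fix c assume c: "c \<in> ?A"
    have f: "finite {k. c k \<noteq> 0}" "c ?o = 0" using c by (auto simp: fin_supp_def excited_def)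
    have "energy a1 a2 a3 V (c(?o := N - particles c)) =
      real (N - particles c) * ?E ?o + (\<Sum>k | c k \<noteq> 0. real (c k) * ?E k)"
      unfolding energy_def using sum_support_upd[OF f, of "\<lambda>k x. real x * ?E k"] by simp
    also have "real (N - particles c) = real N - (\<Sum>k | c k \<noteq> 0. real (c k))"
      using c by (simp add: of_nat_diff particles_def)
    also have "(real N - (\<Sum>k | c k \<noteq> 0. real (c k))) * ?E ?o + (\<Sum>k | c k \<noteq> 0. real (c k) * ?E k)
      = real N * ?E ?o + (\<Sum>k | c k \<noteq> 0. real (c k) * gap a1 a2 a3 V k)"
      by (simp add: gap_def right_diff_distrib sum_subtractf sum_distrib_right left_diff_distrib)
    finally have en: "energy a1 a2 a3 V (c(?o := N - particles c)) =
      real N * ?E ?o + (\<Sum>k | c k \<noteq> 0. real (c k) * gap a1 a2 a3 V k)" .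
    have "weight q c = exp (- \<beta> * (\<Sum>k | c k \<noteq> 0. real (c k) * gap a1 a2 a3 V k))"
      using f by (simp add: weight_def q_def exp_of_nat_mult[symmetric] exp_sum[symmetric]
          sum_distrib_left mult.left_commute sum_negf)
    then have "gibbs_weight \<beta> a1 a2 a3 V (c(?o := N - particles c)) =
      exp (- \<beta> * (real N * ?E ?o)) * weight q c"
      unfolding gibbs_weight_def en by (simp add: distrib_left exp_add[symmetric])
    then show "g (occ_ground (c(?o := N - particles c))) * gibbs_weight \<beta> a1 a2 a3 V (c(?o := N - particles c))
      = exp (- \<beta> * (real N * ?E ?o)) * (g (N - particles c) * weight q c)"
      by (simp add: occ_ground_def)
  qed
  also have "\<dots> = exp (- \<beta> * (real N * ?E ?o)) * (\<Sum>\<^sub>\<infinity>c\<in>?A. g (N - particles c) * weight q c)"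
    by (rule infsum_cmult_right') 
  finally show ?thesis .
qed

text \<open>The ground-state factor and the normalisation cancel in the quotient. The free constant
  Z will be the unconstrained partition function, which makes P a probability and the quotient a
  conditional expectation.\<close>

lemma canon_exp_eq:
  fixes \<beta> a1 a2 a3 V Z :: real and N :: nat
  defines "P \<equiv> \<lambda>c. weight (\<lambda>k. exp (- \<beta> * gap a1 a2 a3 V k)) c / Z"
    and "A \<equiv> {c \<in> fin_supp excited. particles c \<le> N}"
  assumes "Z \<noteq> 0"
  shows "canon_exp \<beta> a1 a2 a3 V N (\<lambda>c. g (occ_ground c)) =
    (\<Sum>\<^sub>\<infinity>c\<in>A. g (N - particles c) * P c) / (\<Sum>\<^sub>\<infinity>c\<in>A. P c)"
proof -
  let ?q = "\<lambda>k. exp (- \<beta> * gap a1 a2 a3 V k)"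
  have "(\<Sum>\<^sub>\<infinity>c\<in>A. h c * P c) = (\<Sum>\<^sub>\<infinity>c\<in>A. h c * weight ?q c) / Z" for h
    unfolding P_def using infsum_cmult_left'[of "\<lambda>c. h c * weight ?q c" "1 / Z" A] by simp
  from this[of "\<lambda>c. g (N - particles c)"] this[of "\<lambda>_. 1"] assms(3) show ?thesis
    unfolding canon_exp_def canon_Z_def A_def
    using canon_sum[where g = g] canon_sum[where g = "\<lambda>_. 1"] by simp
qed

section \<open>Centring and conditioning\<close>

lemma square_le_exp_plus_exp_minus: "x\<^sup>2 \<le> 2 * (exp x + exp (- x :: real))"
proof (cases "0 \<le> x")
  case True
  then show ?thesis using exp_ge_quadratic[OF True] exp_ge_zero[of "- x"] by argo
next
  case False
  then have "0 \<le> - x" by simp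
  from exp_ge_quadratic[OF this] have "1 - x + x\<^sup>2 / 2 \<le> exp (- x)" by simp
  then show ?thesis using False exp_ge_zero[of x] by argo
qed

text \<open>The exponent B r^2 has no linear part, and this forces mean 0 without differentiating
  the transform. The second moment comes from the transform at r0 and -r0 through x^2 \<le> 2 (exp x
  + exp (-x)).\<close>

lemma centred_of_mgf:
  fixes P Y :: "'c \<Rightarrow> real" and G :: "real \<Rightarrow> real"
  assumes P0: "\<And>c. c \<in> C \<Longrightarrow> 0 \<le> P c"
    and mgf: "\<And>r. \<bar>r\<bar> \<le> r0 \<Longrightarrow> ((\<lambda>c. P c * exp (- r * Y c)) has_sum G r) C"
    and P1: "(P has_sum 1) C"
    and G: "\<And>r. \<bar>r\<bar> \<le> r0 \<Longrightarrow> G r \<le> exp (B * r\<^sup>2)"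
    and r0: "0 < r0" and B: "0 \<le> B"
  shows "((\<lambda>c. P c * Y c) has_sum 0) C"
    and "(\<lambda>c. P c * (Y c)\<^sup>2) summable_on C"
    and "(\<Sum>\<^sub>\<infinity>c\<in>C. P c * (Y c)\<^sup>2) \<le> 4 * exp (B * r0\<^sup>2) / r0\<^sup>2"
proof -
  let ?f = "\<lambda>c. (P c * exp (- r0 * Y c) + P c * exp (- (- r0) * Y c)) * (2 / r0\<^sup>2)"
  have hs: "(?f has_sum (G r0 + G (- r0)) * (2 / r0\<^sup>2)) C"
    using r0 by (intro has_sum_cmult_left has_sum_add mgf) auto
  have le: "P c * (Y c)\<^sup>2 \<le> ?f c" if "c \<in> C" for c
  proof -
    have "(r0 * Y c)\<^sup>2 \<le> 2 * (exp (r0 * Y c) + exp (- (r0 * Y c)))"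
      by (rule square_le_exp_plus_exp_minus)
    then have "(Y c)\<^sup>2 \<le> 2 * (exp (r0 * Y c) + exp (- (r0 * Y c))) / r0\<^sup>2"
      using r0 by (simp add: le_divide_eq power_mult_distrib mult.commute)
    from mult_left_mono[OF this P0[OF that]] show ?thesis by (simp add: algebra_simps add_divide_distrib)
  qed
  show s2: "(\<lambda>c. P c * (Y c)\<^sup>2) summable_on C"
    by (rule summable_on_comparison_test[OF has_sum_imp_summable[OF hs] le]) (auto simp: P0)
  have "(\<Sum>\<^sub>\<infinity>c\<in>C. P c * (Y c)\<^sup>2) \<le> (G r0 + G (- r0)) * (2 / r0\<^sup>2)"
    using has_sum_mono[OF has_sum_infsum[OF s2] hs le] .
  also have "\<dots> \<le> (exp (B * r0\<^sup>2) + exp (B * (- r0)\<^sup>2)) * (2 / r0\<^sup>2)"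
    using r0 by (intro mult_right_mono add_mono G) auto
  finally show "(\<Sum>\<^sub>\<infinity>c\<in>C. P c * (Y c)\<^sup>2) \<le> 4 * exp (B * r0\<^sup>2) / r0\<^sup>2" by simp
  have "(\<lambda>c. P c + P c * (Y c)\<^sup>2) summable_on C"
    by (intro summable_on_add s2 has_sum_imp_summable[OF P1])
  then have "(\<lambda>c. norm (P c * Y c)) summable_on C"
  proof (rule summable_on_comparison_test)
    fix c assume "c \<in> C"
    have "\<bar>y\<bar> \<le> 1 + y\<^sup>2" for y :: real
    proof -
      have "0 \<le> (\<bar>y\<bar> - 1)\<^sup>2" by simp
      then have "2 * \<bar>y\<bar> \<le> 1 + y\<^sup>2" by (simp add: power2_diff)
      then show ?thesis by linarith
    qed
    from mult_left_mono[OF this P0[OF \<open>c \<in> C\<close>]]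
    show "norm (P c * Y c) \<le> P c + P c * (Y c)\<^sup>2"
      using P0[OF \<open>c \<in> C\<close>] by (simp add: abs_mult distrib_left)
  qed auto
  then have s1: "(\<lambda>c. P c * Y c) summable_on C" by (rule abs_summable_summable)
  define \<mu> where "\<mu> = (\<Sum>\<^sub>\<infinity>c\<in>C. P c * Y c)"
  have hY: "((\<lambda>c. P c * Y c) has_sum \<mu>) C" unfolding \<mu>_def by (rule has_sum_infsum[OF s1])
  \<comment> \<open>Averaging \<open>1 + u \<le> exp u\<close> at u = - r Y compares the mean with
    the transform.\<close>
  have key: "- r * \<mu> \<le> exp (B * r\<^sup>2) - 1" if "\<bar>r\<bar> \<le> r0" for r
  proof -
    have "((\<lambda>c. P c + P c * Y c * (- r)) has_sum 1 + \<mu> * (- r)) C"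
      by (intro has_sum_add P1 has_sum_cmult_left hY)
    then have "1 + \<mu> * (- r) \<le> G r"
    proof (rule has_sum_mono[OF _ mgf[OF that]])
      fix c assume "c \<in> C"
      from mult_left_mono[OF exp_ge_add_one_self[of "- r * Y c"] P0[OF this]]
      show "P c + P c * Y c * (- r) \<le> P c * exp (- r * Y c)" by (simp add: algebra_simps)
    qed
    with G[OF that] show ?thesis by (simp add: algebra_simps)
  qed
  \<comment> \<open>Both signs of r in \<open>key\<close> bound |\<mu>| by the difference quotient
    at 0 of exp (B r^2), whose derivative there vanishes.\<close>
  have "\<bar>\<mu>\<bar> \<le> 0"
  proof (rule tendsto_lowerbound)
    show "((\<lambda>r. (exp (B * r\<^sup>2) - 1) / r) \<longlongrightarrow> 0) (at_right 0)"
    proof -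
      have "((\<lambda>r. exp (B * r\<^sup>2)) has_real_derivative 0) (at 0)"
        by (auto intro!: derivative_eq_intros)
      then have "((\<lambda>r. (exp (B * r\<^sup>2) - 1) / r) \<longlongrightarrow> 0) (at 0)"
        by (simp add: has_field_derivative_iff)
      then show ?thesis by (rule filterlim_mono[OF _ order_refl at_le]) simp
    qed
    show "\<forall>\<^sub>F r in at_right 0. \<bar>\<mu>\<bar> \<le> (exp (B * r\<^sup>2) - 1) / r"
      unfolding eventually_at_right_field
    proof (intro exI[of _ r0] conjI allI impI r0)
      fix r assume r: "0 < r" "r < r0"
      have "r * \<bar>\<mu>\<bar> \<le> exp (B * r\<^sup>2) - 1" using key[of r] key[of "- r"] r by (auto simp: abs_if)
      then show "\<bar>\<mu>\<bar> \<le> (exp (B * r\<^sup>2) - 1) / r" using r by (simp add: le_divide_eq mult.commute)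
    qed
  qed simp
  then show "((\<lambda>c. P c * Y c) has_sum 0) C" using hY by simp
qed

text \<open>Chebyshev on the complement of A, where Y \<ge> y: there P is at most P Y^2 / y^2, P Y
  at most P Y^2 / y, and exp (-lam Y) at most 1. Subtracting these tails from the full sums 1, 0 and
  G gives the three bounds.\<close>

lemma conditioned_bounds:
  fixes P Y :: "'c \<Rightarrow> real"
  assumes P0: "\<And>c. c \<in> C \<Longrightarrow> 0 \<le> P c"
    and P1: "(P has_sum 1) C"
    and PY: "((\<lambda>c. P c * Y c) has_sum 0) C"
    and PY2: "(\<lambda>c. P c * (Y c)\<^sup>2) summable_on C" "(\<Sum>\<^sub>\<infinity>c\<in>C. P c * (Y c)\<^sup>2) \<le> S"
    and G: "((\<lambda>c. P c * exp (- lam * Y c)) has_sum G) C" and lam: "0 \<le> lam"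
    and A: "A \<subseteq> C" and tail: "\<And>c. c \<in> C \<Longrightarrow> c \<notin> A \<Longrightarrow> y \<le> Y c" and y: "0 < y"
  shows "\<bar>(\<Sum>\<^sub>\<infinity>c\<in>A. P c) - 1\<bar> \<le> S / y\<^sup>2"
    and "\<bar>\<Sum>\<^sub>\<infinity>c\<in>A. P c * Y c\<bar> \<le> S / y"
    and "\<bar>(\<Sum>\<^sub>\<infinity>c\<in>A. P c * exp (- lam * Y c)) - G\<bar> \<le> S / y\<^sup>2"
proof -
  have *: "infsum f A = t - infsum f (C - A)" "f summable_on (C - A)"
    if "(f has_sum t) C" for f :: "'c \<Rightarrow> real" and t
  proof -
    have s: "f summable_on C" using that by (rule has_sum_imp_summable)
    have sA: "f summable_on A" "f summable_on (C - A)" using s A by (auto intro: summable_on_subset_banach)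
    have "infsum f (A \<union> (C - A)) = infsum f A + infsum f (C - A)"
      by (rule infsum_Un_disjoint[OF sA]) auto
    moreover have "A \<union> (C - A) = C" using A by auto
    ultimately show "infsum f A = t - infsum f (C - A)" using infsumI[OF that] by simp
    show "f summable_on (C - A)" by (rule sA)
  qed
  let ?S = "\<Sum>\<^sub>\<infinity>c\<in>C - A. P c * (Y c)\<^sup>2"
  have s2: "(\<lambda>c. P c * (Y c)\<^sup>2) summable_on (C - A)" using PY2 by (auto intro: summable_on_subset_banach)
  have "?S \<le> (\<Sum>\<^sub>\<infinity>c\<in>C. P c * (Y c)\<^sup>2)"
    by (rule infsum_mono2[OF s2 PY2(1)]) (auto simp: P0)
  then have S: "?S \<le> S" using PY2 by simp
  have bnd: "0 \<le> infsum f (C - A) \<and> infsum f (C - A) \<le> S * a"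
    if f: "f summable_on (C - A)" and a: "0 \<le> a" and
      fb: "\<And>c. c \<in> C \<Longrightarrow> y \<le> Y c \<Longrightarrow> 0 \<le> f c \<and> f c \<le> P c * (Y c)\<^sup>2 * a" for f a
  proof -
    have "infsum f (C - A) \<le> (\<Sum>\<^sub>\<infinity>c\<in>C - A. P c * (Y c)\<^sup>2 * a)"
      by (rule infsum_mono[OF f summable_on_cmult_left[OF s2]]) (use fb tail in auto)
    also have "\<dots> = ?S * a" by (rule infsum_cmult_left[OF s2])
    also have "\<dots> \<le> S * a" using S a by (rule mult_right_mono)
    finally have "infsum f (C - A) \<le> S * a" .
    moreover have "0 \<le> infsum f (C - A)" by (rule infsum_nonneg) (use fb tail in auto)
    ultimately show ?thesis by simp
  qed
  have y2: "1 \<le> t\<^sup>2 * (1 / y\<^sup>2)" if "y \<le> t" for t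
    using that y by (simp add: power_mono)
  have Pb: "P c \<le> P c * (Y c)\<^sup>2 * (1 / y\<^sup>2)" if "c \<in> C" "y \<le> Y c" for c
    using mult_left_mono[OF y2[OF that(2)] P0[OF that(1)]] by (simp add: mult.assoc)
  show "\<bar>(\<Sum>\<^sub>\<infinity>c\<in>A. P c) - 1\<bar> \<le> S / y\<^sup>2"
    using bnd[OF *(2)[OF P1], of "1 / y\<^sup>2"] *(1)[OF P1] Pb P0 by auto
  have "0 \<le> P c * Y c \<and> P c * Y c \<le> P c * (Y c)\<^sup>2 * (1 / y)" if "c \<in> C" "y \<le> Y c" for c
  proof -
    have "Y c \<le> (Y c)\<^sup>2 * (1 / y)" using that y by (simp add: power2_eq_square field_simps mult_left_mono)
    from mult_left_mono[OF this P0[OF that(1)]] show ?thesis using that y P0[OF that(1)] by (simp add: mult.assoc)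
  qed
  then show "\<bar>\<Sum>\<^sub>\<infinity>c\<in>A. P c * Y c\<bar> \<le> S / y"
    using bnd[OF *(2)[OF PY], of "1 / y"] *(1)[OF PY] y by auto
  have "0 \<le> P c * exp (- lam * Y c) \<and> P c * exp (- lam * Y c) \<le> P c * (Y c)\<^sup>2 * (1 / y\<^sup>2)"
    if "c \<in> C" "y \<le> Y c" for c
  proof -
    have "P c * exp (- lam * Y c) \<le> P c * 1"
      using that lam y P0[OF that(1)] by (intro mult_left_mono) auto
    also have "\<dots> \<le> P c * (Y c)\<^sup>2 * (1 / y\<^sup>2)" using Pb[OF that] by simp
    finally show ?thesis using P0[OF that(1)] by simp
  qed
  then show "\<bar>(\<Sum>\<^sub>\<infinity>c\<in>A. P c * exp (- lam * Y c)) - G\<bar> \<le> S / y\<^sup>2"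
    using bnd[OF *(2)[OF G], of "1 / y\<^sup>2"] *(1)[OF G] by auto
qed

section \<open>The critical density\<close>

text \<open>Lower Riemann sum: g is even and decreases with the absolute value, so its value at an
  outer endpoint bounds it from below on the adjacent cell and on the mirror image. The two cells
  together have length 2 / L.\<close>

lemma sum_le_nn_integral_even:
  fixes g :: "real \<Rightarrow> ennreal" and L :: real
  assumes g: "\<And>x y. \<bar>x\<bar> \<le> \<bar>y\<bar> \<Longrightarrow> g y \<le> g x" and L: "0 < L"
  shows "2 * (\<Sum>m<R. g (real (m + 1) / L)) \<le> ennreal L * (\<integral>\<^sup>+ y. g y \<partial>lborel)"
proof -
  \<comment> \<open>Cells are open at the inner and closed at the outer end, so membership depends
    only on |y|, different cells are disjoint, and y = 0 lies in none of them.\<close>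
  define D where "D m = {- (real (m + 1) / L)..<- (real m / L)} \<union> {real m / L<..real (m + 1) / L}" for m
  have Dm: "D m \<in> sets lborel" for m unfolding D_def by simp
  have eD: "emeasure lborel (D m) = ennreal (2 / L)" for m
  proof -
    have "emeasure lborel (D m) = emeasure lborel {- (real (m + 1) / L)..<- (real m / L)} + emeasure lborel {real m / L<..real (m + 1) / L}"
      unfolding D_def
    proof (rule plus_emeasure[symmetric])
      have "{- b..<- a} \<inter> {a<..b} = {}" if "0 \<le> a" for a b :: real using that by auto
      then show "{- (real (m + 1) / L)..<- (real m / L)} \<inter> {real m / L<..real (m + 1) / L} = {}"
        using L by simp
    qed auto
    also have "\<dots> = ennreal (1 / L) + ennreal (1 / L)"
      using L by (auto simp: divide_right_mono add_divide_distrib)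
    also have "\<dots> = ennreal (2 / L)" using L by (simp flip: ennreal_plus)
    finally show ?thesis .
  qed
  have Dabs: "y \<in> D m \<longleftrightarrow> real m / L < \<bar>y\<bar> \<and> \<bar>y\<bar> \<le> real (m + 1) / L" for y m
  proof -
    have *: "y \<in> {- b..<- a} \<union> {a<..b} \<longleftrightarrow> a < \<bar>y\<bar> \<and> \<bar>y\<bar> \<le> b" if "0 \<le> a" for a b :: real
      using that by auto
    show ?thesis unfolding D_def by (rule *) (use L in simp)
  qed
  have disj: "m = n" if "y \<in> D m" "y \<in> D n" for y m n
  proof (rule ccontr)
    assume "m \<noteq> n"
    then consider "m + 1 \<le> n" | "n + 1 \<le> m" by linarith
    then show False
    proof cases
      case 1
      then have "real (m + 1) / L \<le> real n / L" using L by (intro divide_right_mono) auto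
      then show False using that by (auto simp: Dabs)
    next
      case 2
      then have "real (n + 1) / L \<le> real m / L" using L by (intro divide_right_mono) auto
      then show False using that by (auto simp: Dabs)
    qed
  qed
  have "(\<Sum>m<R. g (real (m + 1) / L)) * ennreal (2 / L) = (\<Sum>m<R. \<integral>\<^sup>+ y. g (real (m + 1) / L) * indicator (D m) y \<partial>lborel)"
    unfolding sum_distrib_right by (intro sum.cong refl) (simp add: nn_integral_cmult_indicator[OF Dm] eD)
  also have "\<dots> = (\<integral>\<^sup>+ y. (\<Sum>m<R. g (real (m + 1) / L) * indicator (D m) y) \<partial>lborel)"
    using Dm by (intro nn_integral_sum[symmetric]) auto
  also have "\<dots> \<le> (\<integral>\<^sup>+ y. g y \<partial>lborel)"
  proof (rule nn_integral_mono)
    fix y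
    show "(\<Sum>m<R. g (real (m + 1) / L) * indicator (D m) y) \<le> g y"
    proof (cases "\<exists>m<R. y \<in> D m")
      case True
      then obtain m where m: "m < R" "y \<in> D m" by blast
      have "(\<Sum>m<R. g (real (m + 1) / L) * indicator (D m) y) = (\<Sum>n\<in>{m}. g (real (n + 1) / L) * indicator (D n) y)"
        using m disj by (intro sum.mono_neutral_right) (auto simp: indicator_def)
      also have "\<dots> = g (real (m + 1) / L)" using m by simp
      also have "\<dots> \<le> g y" using m L by (intro g) (simp add: Dabs)
      finally show ?thesis .
    next
      case False
      then have "(\<Sum>m<R. g (real (m + 1) / L) * indicator (D m) y) = 0" by (intro sum.neutral) auto
      then show ?thesis by simp
    qed
  qed
  finally have "(\<Sum>m<R. g (real (m + 1) / L)) * ennreal (2 / L) \<le> (\<integral>\<^sup>+ y. g y \<partial>lborel)" .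
  then have "ennreal L * ((\<Sum>m<R. g (real (m + 1) / L)) * ennreal (2 / L)) \<le> ennreal L * (\<integral>\<^sup>+ y. g y \<partial>lborel)"
    by (rule mult_left_mono) simp
  moreover have "ennreal L * (x * ennreal (2 / L)) = 2 * x" for x
  proof -
    have "ennreal L * (x * ennreal (2 / L)) = x * (ennreal L * ennreal (2 / L))" by (simp add: ac_simps)
    also have "ennreal L * ennreal (2 / L) = ennreal (L * (2 / L))" using L by (intro ennreal_mult[symmetric]) auto
    also have "\<dots> = 2" using L by simp
    finally show ?thesis by (simp add: mult.commute)
  qed
  ultimately show ?thesis by simp
qed

section \<open>The density of states as an image of Lebesgue measure\<close>

lemma Fdos_nonneg: "0 \<le> Fdos x" by (simp add: Fdos_def)

lemma mono_Fdos: "x \<le> y \<Longrightarrow> Fdos x \<le> Fdos y"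
  unfolding Fdos_def by (auto intro!: divide_right_mono mult_left_mono powr_mono2)

lemma Fdos_eq: "Fdos x = sqrt 2 / (3 * pi\<^sup>2) * (max 0 x) powr (3/2)"
  by (auto simp: Fdos_def max_def)

lemma continuous_Fdos: "continuous (at_right a) Fdos"
proof -
  have "continuous_on UNIV (\<lambda>x. sqrt 2 / (3 * pi\<^sup>2) * (max 0 x) powr (3/2))"
    by (intro continuous_on_mult continuous_on_powr' continuous_on_max continuous_on_const continuous_on_id) auto
  then have "isCont Fdos a" unfolding Fdos_eq[abs_def] by (simp add: continuous_on_eq_continuous_at)
  then show ?thesis by (rule continuous_at_imp_continuous_at_within)
qed

lemma emeasure_Fdos_Ioc: "a \<le> b \<Longrightarrow> emeasure (interval_measure Fdos) {a<..b} = ennreal (Fdos b - Fdos a)"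
  using mono_Fdos continuous_Fdos by (intro emeasure_interval_measure_Ioc) auto

text \<open>The energy of a plane wave with wave vector \<pi> y, which replaces the discrete
  spectrum in the comparison with an integral.\<close>

definition kin :: "real \<times> real \<times> real \<Rightarrow> real" where
  "kin y = pi\<^sup>2 / 2 * (norm y)\<^sup>2"

lemma kin_measurable [measurable]: "kin \<in> borel_measurable borel"
  unfolding kin_def[abs_def] by measurable

text \<open>The sublevel set is a ball of radius sqrt (2 t) / \<pi>. Its volume is 8 times Fdos
  because Dirichlet modes fill only the positive octant.\<close>

lemma emeasure_kin_le: "emeasure lborel {y. kin y \<le> t} = ennreal (8 * Fdos t)"
proof (cases "t < 0")
  case True
  have "0 \<le> kin y" for y by (simp add: kin_def)
  then have e: "{y. kin y \<le> t} = {}" using True by (metis (mono_tags, lifting) Collect_empty_eq leD order_trans)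
  show ?thesis unfolding e using True by (simp add: Fdos_def)
next
  case False
  define r where "r = sqrt (2 * t) / pi"
  have r0: "0 \<le> r" using False by (simp add: r_def)
  have r2: "r\<^sup>2 = 2 * t / pi\<^sup>2" using False by (simp add: r_def power_divide)
  have "{y. kin y \<le> t} = cball 0 r"
  proof (intro set_eqI)
    fix y :: "real \<times> real \<times> real"
    have "kin y \<le> t \<longleftrightarrow> (norm y)\<^sup>2 \<le> r\<^sup>2" unfolding r2 by (simp add: kin_def field_simps)
    also have "\<dots> \<longleftrightarrow> norm y \<le> r" using r0 by (simp add: power2_le_iff_abs_le)
    finally show "y \<in> {y. kin y \<le> t} \<longleftrightarrow> y \<in> cball 0 r" by simp
  qed
  then have "emeasure lborel {y. kin y \<le> t} = ennreal (unit_ball_vol 3 * r ^ 3)"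
    using emeasure_cball[OF r0, of "0 :: real \<times> real \<times> real"] by (simp add: power3_eq_cube mult.assoc)
  also have "unit_ball_vol 3 * r ^ 3 = 8 * Fdos t"
  proof (cases "t = 0")
    case True then show ?thesis by (simp add: r_def Fdos_def)
  next
    case False
    then have t: "0 < t" using \<open>\<not> t < 0\<close> by simp
    have "t powr (3/2) = t * sqrt t"
      using t powr_add[of t 1 "1/2"] by (simp add: powr_half_sqrt)
    then have F: "Fdos t = sqrt 2 / (3 * pi\<^sup>2) * (t * sqrt t)" using t by (simp add: Fdos_def)
    have "r ^ 3 = r\<^sup>2 * r" by (simp add: power2_eq_square power3_eq_cube)
    also have "\<dots> = 2 * t / pi\<^sup>2 * (sqrt 2 * sqrt t / pi)" unfolding r2 by (simp add: r_def real_sqrt_mult)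
    finally show ?thesis unfolding unit_ball_vol_3 F by (simp add: power2_eq_square)
  qed
  finally show ?thesis .
qed

text \<open>The measures agree on half-open intervals, which form an intersection-stable generator,
  and are finite on \<open>{- real i<..real i}\<close>. This turns integrals against the density of
  states into integrals over three-space.\<close>

lemma distr_kin: "distr lborel borel kin = scale_measure 8 (interval_measure Fdos)"
proof (rule measure_eqI_generator_eq[where E = "range (\<lambda>(a, b). {a<..b::real})" and \<Omega> = UNIV and A = "\<lambda>i::nat. {- real i<..real i}"])
  show "Int_stable (range (\<lambda>(a, b). {a<..b::real}))"
    by (auto simp: Int_stable_def Int_greaterThanAtMost)
  show "sets (distr lborel borel kin) = sigma_sets UNIV (range (\<lambda>(a, b). {a<..b::real}))"
    by (simp add: borel_sigma_sets_Ioc)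
  show "sets (scale_measure 8 (interval_measure Fdos)) = sigma_sets UNIV (range (\<lambda>(a, b). {a<..b::real}))"
    by (simp add: borel_sigma_sets_Ioc)
  have eq: "emeasure (distr lborel borel kin) {a<..b} = ennreal (8 * (Fdos b - Fdos a))" if "a \<le> b" for a b
  proof -
    have "emeasure (distr lborel borel kin) {a<..b} = emeasure lborel ({y. kin y \<le> b} - {y. kin y \<le> a})"
      by (subst emeasure_distr) (auto intro!: arg_cong[where f = "emeasure lborel"])
    also have "\<dots> = emeasure lborel {y. kin y \<le> b} - emeasure lborel {y. kin y \<le> a}"
      using that by (intro emeasure_Diff) (auto simp: emeasure_kin_le)
    also have "\<dots> = ennreal (8 * (Fdos b - Fdos a))"
      using Fdos_nonneg by (simp add: emeasure_kin_le ennreal_minus right_diff_distrib)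
    finally show ?thesis .
  qed
  show "emeasure (distr lborel borel kin) X = emeasure (scale_measure 8 (interval_measure Fdos)) X"
    if X: "X \<in> range (\<lambda>(a, b). {a<..b::real})" for X
  proof -
    obtain a b where X: "X = {a<..b}" using X by auto
    show ?thesis
    proof (cases "a \<le> b")
      case True
      have "ennreal (8 * (Fdos b - Fdos a)) = ennreal 8 * ennreal (Fdos b - Fdos a)"
        using mono_Fdos[OF True] by (intro ennreal_mult) auto
      then show ?thesis using eq[OF True] emeasure_Fdos_Ioc[OF True] by (simp add: X)
    next
      case False then show ?thesis by (simp add: X)
    qed
  qed
  show "(\<Union>i::nat. {- real i<..real i}) = UNIV"
  proof -
    have "\<exists>i::nat. - real i < x \<and> x \<le> real i" for x
    proof -
      obtain i :: nat where "\<bar>x\<bar> < real i" using reals_Archimedean2 by blast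
      then show ?thesis by (intro exI[of _ i]) auto
    qed
    then show ?thesis by auto
  qed
  show "emeasure (distr lborel borel kin) {- real i<..real i} \<noteq> \<infinity>" for i
    by (subst eq) auto
qed auto

text \<open>The value at \<open>\<eta> \<le> 0\<close> makes the occupation density antitone; \<open>nbar 0\<close> is a junk value.\<close>

definition occ :: "real \<Rightarrow> real \<Rightarrow> ennreal" where
  "occ \<beta> \<eta> = (if \<eta> \<le> 0 then top else ennreal (nbar (\<beta> * \<eta>)))"

lemma occ_antimono: "0 < \<beta> \<Longrightarrow> x \<le> y \<Longrightarrow> occ \<beta> y \<le> occ \<beta> x"
  by (auto simp: occ_def intro!: ennreal_leI nbar_antimono)

lemma occ_measurable [measurable]: "occ \<beta> \<in> borel_measurable borel"
  unfolding occ_def[abs_def] nbar_def[abs_def] by measurable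

text \<open>Fdos vanishes on the nonpositive axis, so that axis is a null set and the value top
  assigned there costs nothing.\<close>

lemma nn_integral_occ_pos:
  "(\<integral>\<^sup>+ \<eta>. occ \<beta> \<eta> \<partial>interval_measure Fdos) =
   (\<integral>\<^sup>+ \<eta>. ennreal (nbar (\<beta> * \<eta>)) * indicator {0<..} \<eta> \<partial>interval_measure Fdos)"
proof (rule nn_integral_cong_AE)
  have "emeasure (interval_measure Fdos) (\<Union>i::nat. {- real i<..0}) = 0"
  proof (rule emeasure_UN_eq_0)
    show "emeasure (interval_measure Fdos) {- real i<..0} = 0" for i
      by (subst emeasure_Fdos_Ioc) (auto simp: Fdos_def)
  qed auto
  moreover have "(\<Union>i::nat. {- real i<..0}) = {..0::real}"
  proof -
    have "\<exists>i::nat. - real i < x" for x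
      using reals_Archimedean2[of "- x"] by (metis minus_less_iff)
    then show ?thesis by auto
  qed
  ultimately have "AE \<eta> in interval_measure Fdos. \<eta> \<notin> {..0}"
    by (intro AE_not_in) (auto simp: null_sets_def)
  then show "AE \<eta> in interval_measure Fdos. occ \<beta> \<eta> = ennreal (nbar (\<beta> * \<eta>)) * indicator {0<..} \<eta>"
    by eventually_elim (auto simp: occ_def)
qed

section \<open>Finiteness of the critical density\<close>

lemma Fdos_square: "0 < x \<Longrightarrow> Fdos (x\<^sup>2) = sqrt 2 / (3 * pi\<^sup>2) * x ^ 3"
  using powr_powr[of x 2 "3/2"] by (simp add: Fdos_def powr_numeral)

text \<open>Split into shells that are dyadic in the square root of \<eta>, where Fdos is a cube.
  Below 1 the bound 1 / (\<beta> \<eta>) is integrated, above 1 the bound 2 / (\<beta> \<eta>)^2; in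
  both ranges the shell contributions are geometric with ratio 1/2.\<close>

lemma nn_integral_nbar_finite:
  assumes \<beta>: "0 < \<beta>"
  shows "(\<integral>\<^sup>+ \<eta>. ennreal (nbar (\<beta> * \<eta>)) * indicator {0<..} \<eta> \<partial>interval_measure Fdos) < \<infinity>"
proof -
  define A where "A n = {((1/2::real) ^ (n + 1))\<^sup>2<..((1/2) ^ n)\<^sup>2}" for n :: nat
  define B where "B n = {(2 ^ n)\<^sup>2<..(2 ^ (n + 1))\<^sup>2 :: real}" for n :: nat
  define a where "a n = 1 / (\<beta> * ((1/2) ^ (n + 1))\<^sup>2)" for n :: nat
  define b where "b n = 2 / (\<beta> * (2 ^ n)\<^sup>2)\<^sup>2" for n :: nat
  let ?C = "sqrt 2 / (3 * pi\<^sup>2)"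
  let ?M = "interval_measure Fdos"
  have ab0: "0 \<le> a n" "0 \<le> b n" for n using \<beta> by (auto simp: a_def b_def)
  have "(\<integral>\<^sup>+ \<eta>. ennreal (nbar (\<beta> * \<eta>)) * indicator {0<..} \<eta> \<partial>?M) \<le>
    (\<integral>\<^sup>+ \<eta>. (\<Sum>n. ennreal (a n) * indicator (A n) \<eta> + ennreal (b n) * indicator (B n) \<eta>) \<partial>?M)"
  proof (rule nn_integral_mono)
    fix \<eta> :: real
    have *: "(f n :: ennreal) \<le> (\<Sum>n. f n)" for f and n :: nat
      using sum_le_suminf[of f "{n}"] by simp
    show "ennreal (nbar (\<beta> * \<eta>)) * indicator {0<..} \<eta> \<le>
      (\<Sum>n. ennreal (a n) * indicator (A n) \<eta> + ennreal (b n) * indicator (B n) \<eta>)"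
    proof (cases "0 < \<eta>")
      case pos: True
      show ?thesis
      proof (cases "\<eta> \<le> 1")
        case True
        \<comment> \<open>The least index whose lower endpoint lies below \<eta>; minimality puts
          \<eta> below the upper endpoint, so \<eta> lies in shell n.\<close>
        define n where "n = (LEAST n. ((1/2::real) ^ (n + 1))\<^sup>2 < \<eta>)"
        obtain k :: nat where "(1/4) ^ k < \<eta>" using real_arch_pow_inv[OF pos, of "1/4"] by auto
        moreover have "((1/2::real) ^ (k + 1))\<^sup>2 \<le> (1/4) ^ k"
        proof -
          have "((1/2::real) ^ (k + 1))\<^sup>2 = ((1/2)\<^sup>2) ^ (k + 1)" by (metis power_mult mult.commute)
          also have "\<dots> = (1/4) ^ (k + 1)" by (simp add: power2_eq_square)
          also have "\<dots> \<le> (1/4) ^ k" by simp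
          finally show ?thesis .
        qed
        ultimately have "((1/2::real) ^ (k + 1))\<^sup>2 < \<eta>" by simp
        then have l: "((1/2::real) ^ (n + 1))\<^sup>2 < \<eta>" unfolding n_def by (rule LeastI)
        have u: "\<eta> \<le> ((1/2::real) ^ n)\<^sup>2"
        proof (cases n)
          case 0 then show ?thesis using True by simp
        next
          case (Suc m)
          then have "\<not> ((1/2::real) ^ (m + 1))\<^sup>2 < \<eta>" unfolding n_def
            by (metis (no_types, lifting) lessI n_def not_less_Least)
          then show ?thesis using Suc by simp
        qed
        have "nbar (\<beta> * \<eta>) \<le> 1 / (\<beta> * \<eta>)" using \<beta> pos by (intro nbar_le_inverse) simp
        also have "\<dots> \<le> a n" unfolding a_def using l \<beta> pos by (intro divide_left_mono mult_left_mono mult_pos_pos) auto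
        finally have "ennreal (nbar (\<beta> * \<eta>)) * indicator {0<..} \<eta> \<le> ennreal (a n) * indicator (A n) \<eta>"
          using l u by (auto simp: A_def indicator_def intro: ennreal_leI)
        also have "\<dots> \<le> ennreal (a n) * indicator (A n) \<eta> + ennreal (b n) * indicator (B n) \<eta>" by simp
        also note *[of "\<lambda>n. ennreal (a n) * indicator (A n) \<eta> + ennreal (b n) * indicator (B n) \<eta>" n]
        finally show ?thesis .
      next
        case False
        define n where "n = (LEAST n. \<eta> \<le> (2 ^ (n + 1))\<^sup>2)"
        obtain k :: nat where "\<eta> < 4 ^ k" using real_arch_pow[of 4 \<eta>] by auto
        moreover have "(4::real) ^ k \<le> (2 ^ (k + 1))\<^sup>2"
        proof -
          have "((2::real) ^ (k + 1))\<^sup>2 = (2\<^sup>2) ^ (k + 1)" by (metis power_mult mult.commute)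
          then show ?thesis by simp
        qed
        ultimately have "\<eta> \<le> (2 ^ (k + 1))\<^sup>2" by simp
        then have u: "\<eta> \<le> (2 ^ (n + 1))\<^sup>2" unfolding n_def by (rule LeastI)
        have l: "(2 ^ n)\<^sup>2 < \<eta>"
        proof (cases n)
          case 0 then show ?thesis using False by simp
        next
          case (Suc m)
          then have "\<not> \<eta> \<le> (2 ^ (m + 1))\<^sup>2" unfolding n_def
            by (metis (no_types, lifting) lessI n_def not_less_Least)
          then show ?thesis using Suc by simp
        qed
        have "nbar (\<beta> * \<eta>) \<le> 2 / (\<beta> * \<eta>)\<^sup>2" using \<beta> pos by (intro nbar_le_square) simp
        also have "\<dots> \<le> b n" unfolding b_def using l \<beta> pos
          by (intro divide_left_mono power_mono mult_left_mono mult_pos_pos) auto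
        finally have "ennreal (nbar (\<beta> * \<eta>)) * indicator {0<..} \<eta> \<le> ennreal (b n) * indicator (B n) \<eta>"
          using l u by (auto simp: B_def indicator_def intro: ennreal_leI)
        also have "\<dots> \<le> ennreal (a n) * indicator (A n) \<eta> + ennreal (b n) * indicator (B n) \<eta>" by simp
        also note *[of "\<lambda>n. ennreal (a n) * indicator (A n) \<eta> + ennreal (b n) * indicator (B n) \<eta>" n]
        finally show ?thesis .
      qed
    qed simp
  qed
  also have "\<dots> = (\<Sum>n. \<integral>\<^sup>+ \<eta>. (ennreal (a n) * indicator (A n) \<eta> + ennreal (b n) * indicator (B n) \<eta>) \<partial>?M)"
    by (rule nn_integral_suminf) (simp add: A_def B_def)
  also have "\<dots> = (\<Sum>n. ennreal (a n) * emeasure ?M (A n) + ennreal (b n) * emeasure ?M (B n))"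
    by (simp add: nn_integral_add nn_integral_cmult A_def B_def)
  also have "\<dots> \<le> (\<Sum>n. ennreal ((4 * ?C / \<beta> + 16 * ?C / \<beta>\<^sup>2) * (1/2) ^ n))"
  proof (intro suminf_le summableI)
    fix n
    have "emeasure ?M (A n) \<le> ennreal (Fdos (((1/2) ^ n)\<^sup>2))"
      unfolding A_def using Fdos_nonneg
      by (subst emeasure_Fdos_Ioc) (auto intro!: ennreal_leI power_mono simp: power_decreasing)
    then have "ennreal (a n) * emeasure ?M (A n) \<le> ennreal (a n) * ennreal (?C * ((1/2) ^ n) ^ 3)"
      by (subst (asm) Fdos_square) (auto intro: mult_left_mono)
    also have "\<dots> = ennreal (a n * (?C * ((1/2) ^ n) ^ 3))"
      using ab0 by (intro ennreal_mult[symmetric]) auto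
    also have "a n * (?C * ((1/2) ^ n) ^ 3) = 4 * ?C / \<beta> * (1/2) ^ n"
      by (simp add: a_def power2_eq_square power3_eq_cube) (simp add: ac_simps)
    finally have 1: "ennreal (a n) * emeasure ?M (A n) \<le> ennreal (4 * ?C / \<beta> * (1/2) ^ n)" .
    have "emeasure ?M (B n) \<le> ennreal (Fdos ((2 ^ (n + 1))\<^sup>2))"
      unfolding B_def using Fdos_nonneg
      by (subst emeasure_Fdos_Ioc) (auto intro!: ennreal_leI power_mono)
    then have "ennreal (b n) * emeasure ?M (B n) \<le> ennreal (b n) * ennreal (?C * (2 ^ (n + 1)) ^ 3)"
      by (subst (asm) Fdos_square) (auto intro: mult_left_mono)
    also have "\<dots> = ennreal (b n * (?C * (2 ^ (n + 1)) ^ 3))"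
      using ab0 by (intro ennreal_mult[symmetric]) auto
    also have "b n * (?C * (2 ^ (n + 1)) ^ 3) = 16 * ?C / \<beta>\<^sup>2 * (1/2) ^ n"
      by (simp add: b_def power2_eq_square power3_eq_cube field_simps power_one_over)
    finally have 2: "ennreal (b n) * emeasure ?M (B n) \<le> ennreal (16 * ?C / \<beta>\<^sup>2 * (1/2) ^ n)" .
    show "ennreal (a n) * emeasure ?M (A n) + ennreal (b n) * emeasure ?M (B n)
      \<le> ennreal ((4 * ?C / \<beta> + 16 * ?C / \<beta>\<^sup>2) * (1/2) ^ n)"
      using add_mono[OF 1 2] \<beta> by (subst (asm) ennreal_plus[symmetric]) (auto simp: distrib_right)
  qed
  also have "\<dots> < \<infinity>"
  proof -
    have "summable (\<lambda>n. (4 * ?C / \<beta> + 16 * ?C / \<beta>\<^sup>2) * (1/2::real) ^ n)"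
      by (intro summable_mult summable_geometric) simp
    then show ?thesis using \<beta> by (subst suminf_ennreal2) auto
  qed
  finally show ?thesis .
qed

text \<open>Finiteness supplies integrability; without it the Bochner integral in
  \<open>rho_c\<close> would take its default value 0.\<close>

lemma nn_integral_occ_eq_rho_c:
  assumes \<beta>: "0 < \<beta>"
  shows "(\<integral>\<^sup>+ \<eta>. occ \<beta> \<eta> \<partial>interval_measure Fdos) = ennreal (rho_c \<beta>)" "0 \<le> rho_c \<beta>"
proof -
  let ?f = "\<lambda>\<eta>. indicator {0<..} \<eta> *\<^sub>R (1 / (exp (\<beta> * \<eta>) - 1)) :: real"
  have nn: "0 \<le> ?f \<eta>" for \<eta> using \<beta> by (auto simp: indicator_def)
  have eq: "ennreal (nbar (\<beta> * \<eta>)) * indicator {0<..} \<eta> = ennreal (?f \<eta>)" for \<eta>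
    by (auto simp: indicator_def nbar_def)
  have fin: "(\<integral>\<^sup>+ \<eta>. ennreal (?f \<eta>) \<partial>interval_measure Fdos) < \<infinity>"
    using nn_integral_nbar_finite[OF \<beta>] unfolding eq .
  have "integrable (interval_measure Fdos) ?f"
    using fin nn by (intro integrableI_nonneg) auto
  then have "(\<integral>\<^sup>+ \<eta>. ennreal (?f \<eta>) \<partial>interval_measure Fdos) = ennreal (\<integral>\<eta>. ?f \<eta> \<partial>interval_measure Fdos)"
    using nn by (intro nn_integral_eq_integral) auto
  then show "(\<integral>\<^sup>+ \<eta>. occ \<beta> \<eta> \<partial>interval_measure Fdos) = ennreal (rho_c \<beta>)"
    unfolding nn_integral_occ_pos eq rho_c_def set_lebesgue_integral_def .
  show "0 \<le> rho_c \<beta>"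
    unfolding rho_c_def set_lebesgue_integral_def by (rule Bochner_Integration.integral_nonneg) (rule nn)
qed

section \<open>Lattice sums below the critical density\<close>

lemma kin_triple: "kin (x, y, z) = pi\<^sup>2 / 2 * (x\<^sup>2 + y\<^sup>2 + z\<^sup>2)"
  by (simp add: kin_def norm_Pair)

text \<open>The Riemann comparison is applied to one coordinate at a time. Each application yields a
  factor 2 and a side length; the resulting 8 cancels the 8 in \<open>distr_kin\<close>. The bound
  does not depend on the cutoff R.\<close>

lemma sum_nbar_le_rho_c:
  fixes \<beta> L1 L2 L3 :: real
  assumes \<beta>: "0 < \<beta>" and L: "0 < L1" "0 < L2" "0 < L3"
  shows "(\<Sum>i<R. \<Sum>j<R. \<Sum>l<R. nbar (\<beta> * kin (real (i + 1) / L1, real (j + 1) / L2, real (l + 1) / L3)))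
    \<le> L1 * L2 * L3 * rho_c \<beta>"
proof -
  let ?x = "\<lambda>i. real (i + 1) / L1" and ?y = "\<lambda>i. real (i + 1) / L2" and ?z = "\<lambda>i. real (i + 1) / L3"
  define f where "f x y z = occ \<beta> (kin (x, y, z))" for x y z
  have sq: "\<bar>a\<bar> \<le> \<bar>b\<bar> \<Longrightarrow> a\<^sup>2 \<le> b\<^sup>2" for a b :: real by (simp add: abs_le_square_iff)
  have fm: "f x' y' z' \<le> f x y z" if "\<bar>x\<bar> \<le> \<bar>x'\<bar>" "\<bar>y\<bar> \<le> \<bar>y'\<bar>" "\<bar>z\<bar> \<le> \<bar>z'\<bar>" for x y z x' y' z'
    unfolding f_def using sq[OF that(1)] sq[OF that(2)] sq[OF that(3)]
    by (intro occ_antimono[OF \<beta>]) (auto simp: kin_triple intro!: mult_left_mono)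
  have "8 * (\<Sum>i<R. \<Sum>j<R. \<Sum>l<R. f (?x i) (?y j) (?z l)) =
    2 * (\<Sum>i<R. 2 * (\<Sum>j<R. 2 * (\<Sum>l<R. f (?x i) (?y j) (?z l))))"
    by (simp add: sum_distrib_left[symmetric] mult.assoc[symmetric])
  also have "\<dots> \<le> 2 * (\<Sum>i<R. 2 * (\<Sum>j<R. ennreal L3 * (\<integral>\<^sup>+ z. f (?x i) (?y j) z \<partial>lborel)))"
    using L by (intro mult_left_mono sum_mono sum_le_nn_integral_even fm) auto
  also have "\<dots> = ennreal L3 * (2 * (\<Sum>i<R. 2 * (\<Sum>j<R. \<integral>\<^sup>+ z. f (?x i) (?y j) z \<partial>lborel)))"
    by (simp add: sum_distrib_left ac_simps)
  also have "\<dots> \<le> ennreal L3 * (2 * (\<Sum>i<R. ennreal L2 * (\<integral>\<^sup>+ y. \<integral>\<^sup>+ z. f (?x i) y z \<partial>lborel \<partial>lborel)))"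
    using L by (intro mult_left_mono sum_mono sum_le_nn_integral_even nn_integral_mono fm) auto
  also have "\<dots> = ennreal L3 * (ennreal L2 * (2 * (\<Sum>i<R. \<integral>\<^sup>+ y. \<integral>\<^sup>+ z. f (?x i) y z \<partial>lborel \<partial>lborel)))"
    by (simp add: sum_distrib_left ac_simps)
  also have "\<dots> \<le> ennreal L3 * (ennreal L2 * (ennreal L1 * (\<integral>\<^sup>+ x. \<integral>\<^sup>+ y. \<integral>\<^sup>+ z. f x y z \<partial>lborel \<partial>lborel \<partial>lborel)))"
    using L by (intro mult_left_mono sum_mono sum_le_nn_integral_even nn_integral_mono fm) auto
  also have "(\<integral>\<^sup>+ x. \<integral>\<^sup>+ y. \<integral>\<^sup>+ z. f x y z \<partial>lborel \<partial>lborel \<partial>lborel) = (\<integral>\<^sup>+ p. occ \<beta> (kin p) \<partial>lborel)"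
  proof -
    have "(\<integral>\<^sup>+ p. occ \<beta> (kin p) \<partial>lborel) = (\<integral>\<^sup>+ p. occ \<beta> (kin p) \<partial>(lborel \<Otimes>\<^sub>M lborel))"
      by (simp add: lborel_prod)
    also have "\<dots> = (\<integral>\<^sup>+ x. \<integral>\<^sup>+ q. occ \<beta> (kin (x, q)) \<partial>lborel \<partial>lborel)"
      by (rule lborel.nn_integral_fst[symmetric]) (simp add: lborel_prod)
    also have "\<dots> = (\<integral>\<^sup>+ x. \<integral>\<^sup>+ y. \<integral>\<^sup>+ z. occ \<beta> (kin (x, y, z)) \<partial>lborel \<partial>lborel \<partial>lborel)"
    proof (rule nn_integral_cong)
      fix x :: real
      have m: "(\<lambda>q :: real \<times> real. occ \<beta> (kin (x, q))) \<in> borel_measurable borel"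
        by measurable
      have "(\<integral>\<^sup>+ q. occ \<beta> (kin (x, q)) \<partial>lborel) = (\<integral>\<^sup>+ q. occ \<beta> (kin (x, q)) \<partial>(lborel \<Otimes>\<^sub>M lborel))"
        by (simp add: lborel_prod)
      also have "\<dots> = (\<integral>\<^sup>+ y. \<integral>\<^sup>+ z. occ \<beta> (kin (x, y, z)) \<partial>lborel \<partial>lborel)"
        using m by (intro lborel.nn_integral_fst[symmetric]) (simp add: lborel_prod)
      finally show "(\<integral>\<^sup>+ q. occ \<beta> (kin (x, q)) \<partial>lborel) = (\<integral>\<^sup>+ y. \<integral>\<^sup>+ z. occ \<beta> (kin (x, y, z)) \<partial>lborel \<partial>lborel)" .
    qed
    finally show ?thesis by (simp add: f_def)
  qed
  also have "\<dots> = (\<integral>\<^sup>+ \<eta>. occ \<beta> \<eta> \<partial>distr lborel borel kin)"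
    by (subst nn_integral_distr) auto
  also have "\<dots> = 8 * ennreal (rho_c \<beta>)"
    unfolding distr_kin using nn_integral_occ_eq_rho_c[OF \<beta>] by (simp add: nn_integral_scale_measure)
  also have "ennreal L3 * (ennreal L2 * (ennreal L1 * (8 * ennreal (rho_c \<beta>)))) = ennreal (8 * (L1 * L2 * L3 * rho_c \<beta>))"
    using L nn_integral_occ_eq_rho_c(2)[OF \<beta>] by (simp add: ennreal_mult ac_simps)
  finally have le: "8 * (\<Sum>i<R. \<Sum>j<R. \<Sum>l<R. f (?x i) (?y j) (?z l)) \<le> ennreal (8 * (L1 * L2 * L3 * rho_c \<beta>))" .
  let ?S = "\<Sum>i<R. \<Sum>j<R. \<Sum>l<R. nbar (\<beta> * kin (?x i, ?y j, ?z l))"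
  \<comment> \<open>Lattice points have positive coordinates, so \<open>occ\<close> takes its finite
    value there and the sum can be read in the reals.\<close>
  have kpos: "0 < kin (?x i, ?y j, ?z l)" for i j l
    unfolding kin_triple using L by (intro mult_pos_pos add_pos_pos) auto
  have nn: "0 \<le> nbar (\<beta> * kin (?x i, ?y j, ?z l))" for i j l
    using kpos[of i j l] \<beta> by (intro nbar_nonneg) simp
  have "f (?x i) (?y j) (?z l) = ennreal (nbar (\<beta> * kin (?x i, ?y j, ?z l)))" for i j l
    using kpos[of i j l] unfolding f_def occ_def by (subst if_not_P) auto
  then have "(\<Sum>i<R. \<Sum>j<R. \<Sum>l<R. f (?x i) (?y j) (?z l)) = ennreal ?S"
    using nn by (simp add: sum_ennreal sum_nonneg)
  then have "8 * ennreal ?S \<le> ennreal (8 * (L1 * L2 * L3 * rho_c \<beta>))" using le by simp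
  also have "8 * ennreal ?S = ennreal (8 * ?S)" using nn by (subst ennreal_mult) (auto intro!: sum_nonneg)
  finally have "8 * ?S \<le> 8 * (L1 * L2 * L3 * rho_c \<beta>)"
    using L nn_integral_occ_eq_rho_c(2)[OF \<beta>] by (subst (asm) ennreal_le_iff) auto
  then show ?thesis by simp
qed

section \<open>Occupation numbers of the excited modes\<close>

text \<open>Dominated convergence for unordered sums: the Weierstrass test makes the finite partial
  sums converge uniformly in n, which permits exchanging the two limits.\<close>

lemma tendsto_infsum_dominated:
  fixes f :: "'a \<Rightarrow> 'b \<Rightarrow> real"
  assumes lim: "\<And>k. k \<in> K \<Longrightarrow> (f k \<longlongrightarrow> g k) F"
    and bound: "\<forall>\<^sub>F n in F. \<forall>k\<in>K. \<bar>f k n\<bar> \<le> M k"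
    and M: "M summable_on K" and F: "F \<noteq> bot"
  shows "((\<lambda>n. \<Sum>\<^sub>\<infinity>k\<in>K. f k n) \<longlongrightarrow> (\<Sum>\<^sub>\<infinity>k\<in>K. g k)) F" "g summable_on K"
proof -
  have gM: "\<bar>g k\<bar> \<le> M k" if "k \<in> K" for k
  proof (rule tendsto_upperbound[OF lim[OF that, THEN tendsto_rabs] _ F])
    show "\<forall>\<^sub>F n in F. \<bar>f k n\<bar> \<le> M k" using bound by eventually_elim (use that in auto)
  qed
  have "(\<lambda>k. norm (g k)) summable_on K"
    by (rule summable_on_comparison_test[OF M]) (use gM in auto)
  then show sg: "g summable_on K" by (rule abs_summable_summable)
  let ?S = "{n. \<forall>k\<in>K. \<bar>f k n\<bar> \<le> M k}"
  show "((\<lambda>n. \<Sum>\<^sub>\<infinity>k\<in>K. f k n) \<longlongrightarrow> (\<Sum>\<^sub>\<infinity>k\<in>K. g k)) F"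
  proof (rule swap_uniform_limit')
    show "\<forall>\<^sub>F X in finite_subsets_at_top K. ((\<lambda>n. \<Sum>k\<in>X. f k n) \<longlongrightarrow> (\<Sum>k\<in>X. g k)) F"
      by (rule eventually_finite_subsets_at_top_weakI) (use lim in \<open>auto intro!: tendsto_sum\<close>)
    show "((\<lambda>X. \<Sum>k\<in>X. g k) \<longlongrightarrow> (\<Sum>\<^sub>\<infinity>k\<in>K. g k)) (finite_subsets_at_top K)"
      using has_sum_infsum[OF sg] by (simp add: has_sum_def)
    show "uniform_limit ?S (\<lambda>X n. \<Sum>k\<in>X. f k n) (\<lambda>n. \<Sum>\<^sub>\<infinity>k\<in>K. f k n) (finite_subsets_at_top K)"
      by (rule Weierstrass_m_test_general[OF _ M]) auto
    show "\<forall>\<^sub>F n in F. n \<in> ?S" using bound by simp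
  qed simp
qed

lemma summable_on_Times_mult:
  fixes f :: "'a \<Rightarrow> real" and g :: "'b \<Rightarrow> real"
  assumes "f summable_on A" "g summable_on B"
    and "\<And>x. x \<in> A \<Longrightarrow> 0 \<le> f x" "\<And>y. y \<in> B \<Longrightarrow> 0 \<le> g y"
  shows "(\<lambda>(x, y). f x * g y) summable_on A \<times> B"
proof (rule summable_on_SigmaI)
  show "((\<lambda>y. case (x, y) of (x, y) \<Rightarrow> f x * g y) has_sum f x * infsum g B) B" for x
    using has_sum_cmult_right[OF has_sum_infsum[OF assms(2)]] by simp
  show "(\<lambda>x. f x * infsum g B) summable_on A" by (rule summable_on_cmult_left[OF assms(1)])
qed (use assms in auto)

section \<open>Comparing the energy of a mode with the product of its indices\<close>

definition mode_prod :: "nat \<times> nat \<times> nat \<Rightarrow> real" where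
  "mode_prod k = (case k of (n1, n2, n3) \<Rightarrow> real n1 * real n2 * real n3)"

text \<open>The excitation energy in a cube, in units of \<pi>^2 / 2 and with the side length scaled
  out.\<close>

definition mode_exc :: "nat \<times> nat \<times> nat \<Rightarrow> real" where
  "mode_exc k = (case k of (n1, n2, n3) \<Rightarrow> (real n1)\<^sup>2 + (real n2)\<^sup>2 + (real n3)\<^sup>2 - 3)"

text \<open>A product of three convergent p-series. An index 0 contributes nothing, since
  \<open>0 powr (- p) = 0\<close>.\<close>

lemma summable_mode_prod:
  assumes "1 < p"
  shows "(\<lambda>k. mode_prod k powr (- p)) summable_on A"
proof -
  let ?f = "\<lambda>n. real n powr (- p)"
  have "summable ?f" using assms by (simp add: summable_real_powr_iff)
  then have s: "?f summable_on UNIV" by (subst summable_on_UNIV_nonneg_real_iff) auto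
  have "(\<lambda>(n1, n23). ?f n1 * (case n23 of (n2, n3) \<Rightarrow> ?f n2 * ?f n3)) summable_on UNIV \<times> UNIV \<times> UNIV"
    using s summable_on_Times_mult[OF s s] by (intro summable_on_Times_mult) auto
  also have "(\<lambda>(n1, n23). ?f n1 * (case n23 of (n2, n3) \<Rightarrow> ?f n2 * ?f n3)) = (\<lambda>k. mode_prod k powr (- p))"
    by (auto simp: mode_prod_def fun_eq_iff powr_mult)
  finally show ?thesis by (rule summable_on_subset_banach) simp
qed

text \<open>An excited mode has an index at least 2, so the sum s of squares is at least 6 and
  subtracting 3 removes at most half of it. Each square is at most s, whence the squared product is
  at most s^3. If one index is 1 the product has only two factors and is at most s itself, a better
  exponent.\<close>

lemma excited_bounds:
  assumes "k \<in> excited"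
  shows "3 \<le> mode_exc k" "1 \<le> mode_prod k" "mode_prod k powr (2/3) / 2 \<le> mode_exc k"
    and "k = (n1, n2, n3) \<Longrightarrow> n1 = 1 \<or> n2 = 1 \<or> n3 = 1 \<Longrightarrow> mode_prod k / 2 \<le> mode_exc k"
proof -
  obtain m1 m2 m3 where k: "k = (m1, m2, m3)" by (cases k)
  have m: "1 \<le> m1" "1 \<le> m2" "1 \<le> m3" and ne: "m1 \<noteq> 1 \<or> m2 \<noteq> 1 \<or> m3 \<noteq> 1"
    using assms by (auto simp: k excited_def modes_def)
  let ?a = "(real m1)\<^sup>2" and ?b = "(real m2)\<^sup>2" and ?c = "(real m3)\<^sup>2"
  have sq1: "1 \<le> (real n)\<^sup>2" if "1 \<le> n" for n using that by simp
  have sq4: "4 \<le> (real n)\<^sup>2" if "1 \<le> n" "n \<noteq> 1" for n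
  proof -
    have "2 \<le> real n" using that by linarith
    then have "2\<^sup>2 \<le> (real n)\<^sup>2" by (intro power_mono) auto
    then show ?thesis by simp
  qed
  have s: "1 \<le> ?a" "1 \<le> ?b" "1 \<le> ?c" using m sq1 by auto
  have "6 \<le> ?a + ?b + ?c" using ne sq4[of m1] sq4[of m2] sq4[of m3] m s by linarith
  then show exc3: "3 \<le> mode_exc k" by (simp add: mode_exc_def k)
  have half: "(?a + ?b + ?c) / 2 \<le> mode_exc k" using \<open>6 \<le> _\<close> by (simp add: mode_exc_def k)
  show P1: "1 \<le> mode_prod k" unfolding mode_prod_def k using m
    by (auto intro!: mult_ge1_I)
  let ?s = "?a + ?b + ?c"
  have "(mode_prod k)\<^sup>2 = ?a * ?b * ?c" by (simp add: mode_prod_def k power_mult_distrib)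
  also have "\<dots> \<le> ?s * ?s * ?s" using s by (intro mult_mono) auto
  finally have "(mode_prod k)\<^sup>2 \<le> ?s ^ 3" by (simp add: power3_eq_cube)
  then have "((mode_prod k)\<^sup>2) powr (1/3) \<le> (?s ^ 3) powr (1/3)" by (intro powr_mono2) auto
  also have "(?s ^ 3) powr (1/3) = ?s"
    using s powr_powr[of ?s 3 "1/3"] by (simp add: powr_numeral)
  also have "((mode_prod k)\<^sup>2) powr (1/3) = mode_prod k powr (2/3)"
    using P1 powr_powr[of "mode_prod k" 2 "1/3"] by (simp add: powr_numeral)
  finally show "mode_prod k powr (2/3) / 2 \<le> mode_exc k" using half by argo
  have ag: "real m * real n \<le> (real m)\<^sup>2 + (real n)\<^sup>2" for m n
  proof -
    have "2 * (real m * real n) \<le> (real m)\<^sup>2 + (real n)\<^sup>2"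
      using zero_le_power2[of "real m - real n"] by (simp add: power2_diff)
    moreover have "0 \<le> real m * real n" by simp
    ultimately show ?thesis by argo
  qed
  show "mode_prod k / 2 \<le> mode_exc k" if "k = (n1, n2, n3)" "n1 = 1 \<or> n2 = 1 \<or> n3 = 1"
  proof -
    have eqs: "n1 = m1" "n2 = m2" "n3 = m3" using that k by auto
    have "mode_prod k \<le> ?s"
      using that(2) ag[of m2 m3] ag[of m1 m3] ag[of m1 m2] s unfolding eqs
      by (elim disjE) (auto simp: mode_prod_def k)
    then show ?thesis using half by argo
  qed
qed

locale box =
  fixes a1 a2 a3 \<beta> :: real
  assumes ord: "a1 \<ge> a2" "a2 \<ge> a3" "a3 > 0"
    and sum1: "a1 + a2 + a3 = 1"
    and half: "a1 < 1/2"
    and beta: "\<beta> > 0"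
begin

definition nocc :: "real \<Rightarrow> nat \<times> nat \<times> nat \<Rightarrow> real" where
  "nocc V k = nbar (\<beta> * gap a1 a2 a3 V k)"

definition \<kappa> :: real where "\<kappa> = \<beta> * (pi\<^sup>2 / 2)"

lemma \<kappa>_pos: "0 < \<kappa>" using beta by (simp add: \<kappa>_def)

lemma gap_eq: "gap a1 a2 a3 V (n1, n2, n3) = pi\<^sup>2 / 2 *
    (((real n1)\<^sup>2 - 1) * V powr (- 2 * a1) + ((real n2)\<^sup>2 - 1) * V powr (- 2 * a2) + ((real n3)\<^sup>2 - 1) * V powr (- 2 * a3))"
  by (simp add: gap_def eigval_def algebra_simps)

text \<open>For V \<ge> 1 the longest side, with exponent a1, has the finest level spacing;
  replacing the other spacings by it lowers the gap.\<close>

lemma gap_ge: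
  assumes "k \<in> excited" "1 \<le> V"
  shows "V powr (- 2 * a1) * \<kappa> * mode_exc k \<le> \<beta> * gap a1 a2 a3 V k"
proof -
  obtain n1 n2 n3 where k: "k = (n1, n2, n3)" by (cases k)
  have n: "1 \<le> n1" "1 \<le> n2" "1 \<le> n3" using assms by (auto simp: k excited_def modes_def)
  have "V powr (- 2 * a1) \<le> V powr (- 2 * a2)" "V powr (- 2 * a1) \<le> V powr (- 2 * a3)"
    using assms ord by (auto intro!: powr_mono)
  then have "((real n1)\<^sup>2 - 1) * V powr (- 2 * a1) + ((real n2)\<^sup>2 - 1) * V powr (- 2 * a1) + ((real n3)\<^sup>2 - 1) * V powr (- 2 * a1)
     \<le> ((real n1)\<^sup>2 - 1) * V powr (- 2 * a1) + ((real n2)\<^sup>2 - 1) * V powr (- 2 * a2) + ((real n3)\<^sup>2 - 1) * V powr (- 2 * a3)"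
    using n by (intro add_mono mult_left_mono) auto
  then have "\<kappa> * (((real n1)\<^sup>2 - 1) * V powr (- 2 * a1) + ((real n2)\<^sup>2 - 1) * V powr (- 2 * a1) + ((real n3)\<^sup>2 - 1) * V powr (- 2 * a1))
     \<le> \<beta> * gap a1 a2 a3 V k"
    unfolding k gap_eq \<kappa>_def mult.assoc using beta by (intro mult_left_mono) auto
  then show ?thesis by (simp add: k mode_exc_def algebra_simps)
qed

lemma gap_pos: "k \<in> excited \<Longrightarrow> 1 \<le> V \<Longrightarrow> 0 < \<beta> * gap a1 a2 a3 V k"
  by (rule less_le_trans[OF _ gap_ge]) (use \<kappa>_pos excited_bounds(1)[of k] in auto)

lemma nocc_nonneg: "k \<in> excited \<Longrightarrow> 1 \<le> V \<Longrightarrow> 0 \<le> nocc V k"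
  unfolding nocc_def using gap_pos[of k V] by (intro nbar_nonneg) simp

text \<open>The majorant of all cumulants, independent of V. Here 40 = 10 * 2^2: the 10 is 2 + 8
  from the two terms of \<open>nocc_bounds\<close>, the square undoes the halving in
  \<open>excited_bounds\<close>; the exponent is twice 2/3.\<close>

definition dominant :: "nat \<times> nat \<times> nat \<Rightarrow> real" where
  "dominant k = 40 / \<kappa>\<^sup>2 * mode_prod k powr (- (4/3))"

lemma dominant_summable: "dominant summable_on A"
  unfolding dominant_def[abs_def] by (intro summable_on_cmult_right summable_mode_prod) simp

text \<open>The bounds nbar x \<le> 1 / x and nbar x \<le> 2 / x^2 cancel the powers of v exactly,
  so both estimates are uniform in V. The second left-hand side is that of
  \<open>cumul_le_small\<close> at s = v.\<close>

lemma nocc_bounds: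
  assumes k: "k \<in> excited" and V: "1 \<le> V"
  defines "v \<equiv> V powr (- 2 * a1)"
  shows "v * nocc V k \<le> 1 / (3 * \<kappa>)"
    and "v\<^sup>2 * nocc V k + 8 * (v\<^sup>2 * (nocc V k)\<^sup>2) \<le> dominant k"
proof -
  let ?x = "\<kappa> * mode_exc k"
  have v: "0 < v" using V by (simp add: v_def)
  have x: "0 < ?x" using \<kappa>_pos excited_bounds(1)[OF k] by simp
  have vx: "0 < v * ?x" using v x by simp
  have le: "nocc V k \<le> nbar (v * ?x)" unfolding nocc_def
    using gap_ge[OF k V] vx by (intro nbar_antimono) (auto simp: v_def mult.assoc)
  have "v * nocc V k \<le> v * (1 / (v * ?x))"
    using le nbar_le_inverse[OF vx] v by (intro mult_left_mono) auto
  also have "\<dots> = 1 / ?x" using v by simp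
  finally have 1: "v * nocc V k \<le> 1 / ?x" .
  also have "\<dots> \<le> 1 / (3 * \<kappa>)" using \<kappa>_pos excited_bounds(1)[OF k] x
    by (intro divide_left_mono mult_pos_pos) auto
  finally show "v * nocc V k \<le> 1 / (3 * \<kappa>)" .
  have 2: "v\<^sup>2 * (nocc V k)\<^sup>2 \<le> 1 / ?x\<^sup>2"
    using power_mono[OF 1, of 2] v nocc_nonneg[OF k V] by (simp add: power_mult_distrib power_divide)
  have "v\<^sup>2 * nocc V k \<le> v\<^sup>2 * (2 / (v * ?x)\<^sup>2)"
    using le nbar_le_square[OF vx] v by (intro mult_left_mono) auto
  also have "\<dots> = 2 / ?x\<^sup>2" using v by (simp add: power_mult_distrib)
  finally have "v\<^sup>2 * nocc V k + 8 * (v\<^sup>2 * (nocc V k)\<^sup>2) \<le> 10 / ?x\<^sup>2" using 2 by simp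
  also have "\<dots> \<le> 10 / (\<kappa> * (mode_prod k powr (2/3) / 2))\<^sup>2"
    using \<kappa>_pos excited_bounds(2,3)[OF k] x
    by (intro divide_left_mono power_mono mult_left_mono mult_pos_pos) auto
  also have "\<dots> = 40 / \<kappa>\<^sup>2 * (1 / (mode_prod k powr (2/3))\<^sup>2)"
    by (simp add: power_mult_distrib power_divide)
  also have "1 / (mode_prod k powr (2/3))\<^sup>2 = mode_prod k powr (- (4/3))"
    unfolding power2_eq_square powr_add[symmetric] powr_minus_divide by simp
  finally show "v\<^sup>2 * nocc V k + 8 * (v\<^sup>2 * (nocc V k)\<^sup>2) \<le> dominant k" by (simp add: dominant_def)
qed

lemma nocc_summable:
  assumes V: "1 \<le> V" shows "nocc V summable_on excited"
proof -
  let ?v = "V powr (- 2 * a1)"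
  have v: "0 < ?v" using V by simp
  have "(\<lambda>k. dominant k * (1 / ?v\<^sup>2)) summable_on excited"
    by (intro summable_on_cmult_left dominant_summable)
  then show ?thesis
  proof (rule summable_on_comparison_test)
    fix k assume k: "k \<in> excited"
    have "?v\<^sup>2 * nocc V k \<le> dominant k" using nocc_bounds(2)[OF k V] zero_le_power2[of "?v * nocc V k"]
      unfolding power_mult_distrib by linarith
    then show "nocc V k \<le> dominant k * (1 / ?v\<^sup>2)" using v by (simp add: le_divide_eq mult.commute)
    show "0 \<le> nocc V k" by (rule nocc_nonneg[OF k V])
  qed
qed

section \<open>The mean number of excited particles\<close>

definition interior_modes :: "(nat \<times> nat \<times> nat) set" where
  "interior_modes = {2..} \<times> {2..} \<times> {2..}"

lemma interior_modes_subset: "interior_modes \<subseteq> excited"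
  by (auto simp: interior_modes_def excited_def modes_def)

text \<open>Writing an index as i + 2, the inequality (i + 1)^2 \<le> (i + 2)^2 - 1 puts the gap
  above the kinetic energy at a positive lattice point, so subtracting the ground-state energy
  causes no error term. The sides multiply to V.\<close>

lemma infsum_nocc_inner:
  assumes V: "1 \<le> V"
  shows "infsum (nocc V) interior_modes \<le> V * rho_c \<beta>"
proof (rule infsum_le_finite_sums)
  show "nocc V summable_on interior_modes"
    by (rule summable_on_subset_banach[OF nocc_summable[OF V] interior_modes_subset])
  fix S assume S: "finite S" "S \<subseteq> interior_modes"
  \<comment> \<open>One more than every index in S, so that the shifted set lies in a cube of R^3
    lattice points.\<close>
  define R where "R = Max (insert 0 ((\<lambda>(a, b, c). max a (max b c)) ` S)) + 1"
  have R: "a < R \<and> b < R \<and> c < R" if "(a, b, c) \<in> S" for a b c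
  proof -
    have "max a (max b c) \<le> Max (insert 0 ((\<lambda>(a, b, c). max a (max b c)) ` S))"
      using S that by (intro Max_ge) force+
    then show ?thesis unfolding R_def by linarith
  qed
  let ?g = "\<lambda>(i, j, l). (i + 2, j + 2, l + 2 :: nat)"
  let ?B = "{..<R} \<times> {..<R} \<times> {..<R}"
  have sub: "S \<subseteq> ?g ` ?B"
  proof
    fix k assume "k \<in> S"
    then obtain a b c where k: "k = (a, b, c)" "2 \<le> a" "2 \<le> b" "2 \<le> c" "(a, b, c) \<in> S"
      using S by (auto simp: interior_modes_def)
    then have "k = ?g (a - 2, b - 2, c - 2)" "(a - 2, b - 2, c - 2) \<in> ?B" using R[of a b c] by auto
    then show "k \<in> ?g ` ?B" by blast
  qed
  have inj: "inj_on ?g ?B" by (auto simp: inj_on_def)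
  have gex: "?g p \<in> excited" for p by (cases p) (auto simp: excited_def modes_def)
  let ?L = "\<lambda>a. V powr a"
  have L: "0 < ?L a" for a using V by simp
  have "sum (nocc V) S \<le> sum (nocc V) (?g ` ?B)"
    using sub gex nocc_nonneg[OF _ V] by (intro sum_mono2) auto
  also have "\<dots> = (\<Sum>p\<in>?B. nocc V (?g p))" unfolding sum.reindex[OF inj] by (simp only: o_def)
  also have "\<dots> \<le> (\<Sum>(i, j, l)\<in>?B. nbar (\<beta> * kin (real (i + 1) / ?L a1, real (j + 1) / ?L a2, real (l + 1) / ?L a3)))"
  proof (rule sum_mono)
    fix p assume "p \<in> ?B"
    obtain i j l where p: "p = (i, j, l)" by (cases p)
    have sq: "(real (i + 1) / ?L a)\<^sup>2 \<le> ((real (i + 2))\<^sup>2 - 1) * V powr (- 2 * a)" for i a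
    proof -
      have "V powr (- 2 * a) = 1 / (?L a)\<^sup>2"
        using powr_powr[of V a 2] V by (simp add: powr_numeral powr_minus divide_inverse mult.commute)
      moreover have "(real (i + 1))\<^sup>2 \<le> (real (i + 2))\<^sup>2 - 1" by (simp add: power2_eq_square algebra_simps)
      ultimately show ?thesis using L[of a] by (simp add: power_divide divide_right_mono)
    qed
    have "kin (real (i + 1) / ?L a1, real (j + 1) / ?L a2, real (l + 1) / ?L a3) \<le> gap a1 a2 a3 V (?g p)"
      unfolding kin_triple p prod.case gap_eq by (intro mult_left_mono add_mono sq) auto
    moreover have "0 < kin (real (i + 1) / ?L a1, real (j + 1) / ?L a2, real (l + 1) / ?L a3)"
      unfolding kin_triple using L by (intro mult_pos_pos add_pos_pos) auto
    ultimately have "nocc V (?g p) \<le> nbar (\<beta> * kin (real (i + 1) / ?L a1, real (j + 1) / ?L a2, real (l + 1) / ?L a3))"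
      unfolding nocc_def using beta by (intro nbar_antimono) auto
    then show "nocc V (?g p) \<le> (case p of (i, j, l) \<Rightarrow> nbar (\<beta> * kin (real (i + 1) / ?L a1, real (j + 1) / ?L a2, real (l + 1) / ?L a3)))"
      by (simp add: p)
  qed
  also have "\<dots> = (\<Sum>i<R. \<Sum>j<R. \<Sum>l<R. nbar (\<beta> * kin (real (i + 1) / ?L a1, real (j + 1) / ?L a2, real (l + 1) / ?L a3)))"
    by (simp add: sum.cartesian_product)
  also have "\<dots> \<le> ?L a1 * ?L a2 * ?L a3 * rho_c \<beta>"
    by (rule sum_nbar_le_rho_c[OF beta L L L])
  also have "?L a1 * ?L a2 * ?L a3 = V" using V sum1 by (simp flip: powr_add)
  finally show "sum (nocc V) S \<le> V * rho_c \<beta>" .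
qed

lemma a1_ge: "1/3 \<le> a1" using ord sum1 by linarith

text \<open>Modes with some index 1 are not covered by the Riemann comparison. For them the energy
  grows linearly in the index product, and a power p > 1 gives a convergent sum times V to the power
  2 a1 p, which is o(V).\<close>

lemma infsum_nocc_le:
  obtains C p where "0 \<le> C" "2 * a1 * p < 1"
    "\<And>V. 1 \<le> V \<Longrightarrow> infsum (nocc V) excited \<le> V * rho_c \<beta> + C * V powr (2 * a1 * p)"
proof -
  \<comment> \<open>The midpoint of 1 and 1 / (2 a1), a nonempty interval because a1 < 1/2. The
    lower end gives summability, the upper end 2 a1 p < 1; a1 \<ge> 1/3 keeps p below 2.\<close>
  define p where "p = (1 + 1 / (2 * a1)) / 2"
  have a1: "0 < a1" using a1_ge by linarith
  have p: "1 < p" using half a1 by (simp add: p_def field_simps)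
  have p2: "p \<le> 2" using a1_ge a1 by (simp add: p_def field_simps)
  have ap: "2 * a1 * p < 1" using half a1 by (simp add: p_def field_simps)
  define C where "C = 2 * (\<kappa> / 2) powr (- p) * infsum (\<lambda>k. mode_prod k powr (- p)) (excited - interior_modes)"
  show thesis
  proof (rule that[of C p])
    show "0 \<le> C" unfolding C_def by (intro mult_nonneg_nonneg infsum_nonneg) auto
    show "2 * a1 * p < 1" by (rule ap)
    fix V :: real assume V: "1 \<le> V"
    let ?v = "V powr (- 2 * a1)"
    have v: "0 < ?v" using V by simp
    have sN: "nocc V summable_on B" if "B \<subseteq> excited" for B
      by (rule summable_on_subset_banach[OF nocc_summable[OF V] that])
    have "infsum (nocc V) (interior_modes \<union> (excited - interior_modes)) = infsum (nocc V) interior_modes + infsum (nocc V) (excited - interior_modes)"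
      by (rule infsum_Un_disjoint) (use sN interior_modes_subset in auto)
    moreover have "interior_modes \<union> (excited - interior_modes) = excited" using interior_modes_subset by auto
    moreover have "infsum (nocc V) (excited - interior_modes) \<le> (\<Sum>\<^sub>\<infinity>k\<in>excited - interior_modes. 2 * (\<kappa> / 2) powr (- p) * V powr (2 * a1 * p) * mode_prod k powr (- p))"
    proof (rule infsum_mono)
      show "nocc V summable_on (excited - interior_modes)" by (rule sN) auto
      show "(\<lambda>k. 2 * (\<kappa> / 2) powr (- p) * V powr (2 * a1 * p) * mode_prod k powr (- p)) summable_on (excited - interior_modes)"
        by (intro summable_on_cmult_right summable_mode_prod p)
      fix k assume "k \<in> excited - interior_modes"
      then have k: "k \<in> excited" "k \<notin> interior_modes" by auto
      obtain n1 n2 n3 where kk: "k = (n1, n2, n3)" by (cases k)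
      have "n1 = 1 \<or> n2 = 1 \<or> n3 = 1" using k by (auto simp: kk interior_modes_def excited_def modes_def)
      then have e: "mode_prod k / 2 \<le> mode_exc k" using excited_bounds(4)[OF k(1) kk] by blast
      have P: "1 \<le> mode_prod k" by (rule excited_bounds(2)[OF k(1)])
      have "?v * (\<kappa> / 2) * mode_prod k \<le> ?v * \<kappa> * mode_exc k"
        using mult_left_mono[OF e, of "?v * \<kappa>"] v \<kappa>_pos by simp
      also have "\<dots> \<le> \<beta> * gap a1 a2 a3 V k" by (rule gap_ge[OF k(1) V])
      finally have "nocc V k \<le> nbar (?v * (\<kappa> / 2) * mode_prod k)"
        unfolding nocc_def using v \<kappa>_pos P by (intro nbar_antimono) auto
      also have "\<dots> \<le> 2 * (?v * (\<kappa> / 2) * mode_prod k) powr (- p)"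
        using v \<kappa>_pos P p p2 by (intro nbar_le_powr) auto
      also have "\<dots> = 2 * (\<kappa> / 2) powr (- p) * V powr (2 * a1 * p) * mode_prod k powr (- p)"
      proof -
        have "(?v * (\<kappa> / 2) * mode_prod k) powr (- p) = ?v powr (- p) * (\<kappa> / 2) powr (- p) * mode_prod k powr (- p)"
          using v \<kappa>_pos P by (subst powr_mult; (subst powr_mult)?) auto
        moreover have "?v powr (- p) = V powr (2 * a1 * p)" by (simp add: powr_powr)
        ultimately show ?thesis by (simp only: ac_simps)
      qed
      finally show "nocc V k \<le> 2 * (\<kappa> / 2) powr (- p) * V powr (2 * a1 * p) * mode_prod k powr (- p)" .
    qed
    moreover have "\<dots> = C * V powr (2 * a1 * p)"
      by (simp add: infsum_cmult_right' C_def)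
    ultimately show "infsum (nocc V) excited \<le> V * rho_c \<beta> + C * V powr (2 * a1 * p)"
      using infsum_nocc_inner[OF V] by simp
  qed
qed

end

section \<open>The limiting cumulants\<close>

text \<open>As v tends to 0 the occupation behaves like 1 / (\<beta> v x), so both s n and (1 - exp
  (-s)) n tend to lam / (\<beta> x).\<close>

lemma cumul_nbar_limit:
  fixes \<beta> lam x :: real
  assumes "0 < \<beta>" "0 < lam" "0 < x"
  shows "((\<lambda>v. cumul (lam * v) (nbar (\<beta> * (v * x)))) \<longlongrightarrow> h_fun \<beta> lam x) (at_right 0)"
proof -
  define c where "c = \<beta> * x"
  have c: "0 < c" using assms by (simp add: c_def)
  have 1: "((\<lambda>v. lam * v * (1 / (exp (c * v) - 1))) \<longlongrightarrow> lam * inverse c) (at_right 0)"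
    using c assms by real_asymp
  have 2: "((\<lambda>v. (1 - exp (- (lam * v))) * (1 / (exp (c * v) - 1))) \<longlongrightarrow> lam * inverse c) (at_right 0)"
    using c assms by real_asymp
  have "((\<lambda>v. lam * v * (1 / (exp (c * v) - 1)) - ln (1 + (1 - exp (- (lam * v))) * (1 / (exp (c * v) - 1))))
      \<longlongrightarrow> lam * inverse c - ln (1 + lam * inverse c)) (at_right 0)"
  proof (intro tendsto_diff tendsto_ln tendsto_add tendsto_const 1 2)
    have "0 < lam * inverse c" using c assms by simp
    then show "1 + lam * inverse c \<noteq> 0" by linarith
  qed
  then show ?thesis by (simp add: cumul_def nbar_def h_fun_def c_def divide_inverse ac_simps)
qed

section \<open>Limits and uniform bounds of the cumulants in the box\<close>

context box begin

text \<open>A mode survives only if it is unexcited in every direction shorter than the first;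
  otherwise its gap diverges on the scale V powr (-2 a1).\<close>

definition limit_term :: "real \<Rightarrow> nat \<times> nat \<times> nat \<Rightarrow> real" where
  "limit_term lam k = (case k of (n1, n2, n3) \<Rightarrow>
     if (a2 = a1 \<or> n2 = 1) \<and> (a3 = a1 \<or> n3 = 1) then h_fun \<beta> lam (e_fun n1 + e_fun n2 + e_fun n3) else 0)"

text \<open>Against the bound 1 / (3 \<kappa>) of \<open>nocc_bounds\<close>, the value 3 \<kappa> /
  4 yields the 1/4 required by \<open>cumul_le_small\<close>.\<close>

definition r0 :: real where "r0 = min 1 (3 * \<kappa> / 4)"

lemma r0_pos: "0 < r0" using \<kappa>_pos by (simp add: r0_def)

text \<open>Nonnegative r of any size is covered by \<open>cumul_le\<close>, which serves the given
  lam; negative r must be small, which suffices for centring.\<close>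

lemma cumul_dom:
  assumes k: "k \<in> excited" and V: "1 \<le> V" and r: "0 \<le> r \<or> \<bar>r\<bar> \<le> r0"
  defines "s \<equiv> r * V powr (- 2 * a1)"
  shows "0 < 1 + (1 - exp (- s)) * nocc V k" "0 \<le> cumul s (nocc V k)" "cumul s (nocc V k) \<le> r\<^sup>2 * dominant k"
proof -
  let ?v = "V powr (- 2 * a1)" and ?n = "nocc V k"
  have n: "0 \<le> ?n" by (rule nocc_nonneg[OF k V])
  have v: "0 < ?v" "?v \<le> 1" using V a1_ge powr_mono[of "- 2 * a1" 0 V] by auto
  have b: "r\<^sup>2 * (?v\<^sup>2 * ?n + 8 * (?v\<^sup>2 * ?n\<^sup>2)) \<le> r\<^sup>2 * dominant k"
    using nocc_bounds(2)[OF k V] by (intro mult_left_mono) auto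
  have A: "0 < 1 + (1 - exp (- s)) * ?n \<and> cumul s ?n \<le> s\<^sup>2 * ?n + 8 * (s\<^sup>2 * ?n\<^sup>2)"
  proof (cases "0 \<le> r")
    case True
    then have s: "0 \<le> s" using v by (simp add: s_def)
    have "0 \<le> (1 - exp (- s)) * ?n" using s n by simp
    moreover have "0 \<le> s\<^sup>2 * ?n" "0 \<le> s\<^sup>2 * ?n\<^sup>2" using n by auto
    ultimately show ?thesis using cumul_le[OF n s] by linarith
  next
    case False
    then have r: "\<bar>r\<bar> \<le> 1" "\<bar>r\<bar> \<le> 3 * \<kappa> / 4" using r by (auto simp: r0_def)
    have "\<bar>s\<bar> \<le> 1" unfolding s_def abs_mult using r v by (intro mult_le_one) auto
    moreover have "\<bar>s\<bar> * ?n \<le> 1/4"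
    proof -
      have "\<bar>s\<bar> * ?n = \<bar>r\<bar> * (?v * ?n)" using v by (simp add: s_def abs_mult)
      also have "\<dots> \<le> (3 * \<kappa> / 4) * (1 / (3 * \<kappa>))"
        using r nocc_bounds(1)[OF k V] n v \<kappa>_pos by (intro mult_mono) auto
      also have "\<dots> = 1/4" using \<kappa>_pos by simp
      finally show ?thesis .
    qed
    ultimately show ?thesis using cumul_le_small[OF n] by blast
  qed
  then show pos: "0 < 1 + (1 - exp (- s)) * ?n" by simp
  show "0 \<le> cumul s ?n" by (rule cumul_nonneg[OF n pos])
  have "s\<^sup>2 * ?n + 8 * (s\<^sup>2 * ?n\<^sup>2) = r\<^sup>2 * (?v\<^sup>2 * ?n + 8 * (?v\<^sup>2 * ?n\<^sup>2))"
    unfolding s_def power_mult_distrib by (simp add: algebra_simps)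
  then show "cumul s ?n \<le> r\<^sup>2 * dominant k" using A b by linarith
qed

lemma scale_to_zero: "((\<lambda>V. V powr (- 2 * a1)) \<longlongrightarrow> 0) at_top"
  using a1_ge by real_asymp

text \<open>If the gap is exactly proportional to V powr (-2 a1), the previous limit applies.
  Otherwise a shorter direction is excited, v n tends to 0, and the quadratic bound on the cumulant
  vanishes.\<close>

lemma cumul_limit:
  assumes k: "k \<in> excited" and lam: "0 < lam"
  shows "((\<lambda>V. cumul (lam * V powr (- 2 * a1)) (nocc V k)) \<longlongrightarrow> limit_term lam k) at_top"
proof -
  obtain n1 n2 n3 where kk: "k = (n1, n2, n3)" by (cases k)
  have n: "1 \<le> n1" "1 \<le> n2" "1 \<le> n3" using k by (auto simp: kk excited_def modes_def)
  show ?thesis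
  proof (cases "(a2 = a1 \<or> n2 = 1) \<and> (a3 = a1 \<or> n3 = 1)")
    case True
    let ?x = "e_fun n1 + e_fun n2 + e_fun n3"
    have x: "?x = pi\<^sup>2 / 2 * mode_exc k"
      by (simp add: e_fun_def mode_exc_def kk algebra_simps add_divide_distrib diff_divide_distrib)
    have x0: "0 < ?x" unfolding x using excited_bounds(1)[OF k] by simp
    have "gap a1 a2 a3 V k = V powr (- 2 * a1) * ?x" for V
    proof -
      \<comment> \<open>Either the exponents coincide or the index is 1 and the coefficient is
        0.\<close>
      have 2: "((real n2)\<^sup>2 - 1) * V powr (- 2 * a2) = ((real n2)\<^sup>2 - 1) * V powr (- 2 * a1)"
        and 3: "((real n3)\<^sup>2 - 1) * V powr (- 2 * a3) = ((real n3)\<^sup>2 - 1) * V powr (- 2 * a1)"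
        using True by auto
      show ?thesis unfolding kk gap_eq 2 3 e_fun_def by (simp add: algebra_simps add_divide_distrib diff_divide_distrib)
    qed
    then have eq: "nocc V k = nbar (\<beta> * (V powr (- 2 * a1) * ?x))" for V by (simp add: nocc_def)
    have "filterlim (\<lambda>V. V powr (- 2 * a1)) (at_right 0) at_top"
      unfolding filterlim_at using scale_to_zero
      by (auto intro: eventually_mono[OF eventually_gt_at_top[of 0]])
    from filterlim_compose[OF cumul_nbar_limit[OF beta lam x0] this]
    show ?thesis using True unfolding eq by (simp add: limit_term_def kk)
  next
    case False
    have "\<exists>a n. 1 \<le> n \<and> n \<noteq> 1 \<and> a < a1 \<and> (\<forall>V\<ge>1. pi\<^sup>2 / 2 * (((real n)\<^sup>2 - 1) * V powr (- 2 * a)) \<le> gap a1 a2 a3 V k)"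
    proof -
      have nn: "0 \<le> ((real n)\<^sup>2 - 1) * V powr a" if "1 \<le> n" for n V a using that by simp
      have "pi\<^sup>2 / 2 * (((real n2)\<^sup>2 - 1) * V powr (- 2 * a2)) \<le> gap a1 a2 a3 V k"
         "pi\<^sup>2 / 2 * (((real n3)\<^sup>2 - 1) * V powr (- 2 * a3)) \<le> gap a1 a2 a3 V k" for V
        unfolding kk gap_eq using nn[OF n(1)] nn[OF n(2)] nn[OF n(3)]
        by (intro mult_left_mono; simp)+
      then show ?thesis using False ord n by (metis order_le_imp_less_or_eq order_trans)
    qed
    then obtain a m where am: "1 \<le> m" "m \<noteq> 1" "a < a1"
      and ge: "\<And>V. 1 \<le> V \<Longrightarrow> pi\<^sup>2 / 2 * (((real m)\<^sup>2 - 1) * V powr (- 2 * a)) \<le> gap a1 a2 a3 V k" by blast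
    define b where "b = \<beta> * (pi\<^sup>2 / 2 * ((real m)\<^sup>2 - 1))"
    have "1 < real m" using am by linarith
    then have b: "0 < b" using beta by (simp add: b_def one_less_power)
    have vn: "V powr (- 2 * a1) * nocc V k \<le> 1 / b * V powr (- 2 * (a1 - a))" if V: "1 \<le> V" for V
    proof -
      have ba: "0 < b * V powr (- 2 * a)" using b V by simp
      have "b * V powr (- 2 * a) \<le> \<beta> * gap a1 a2 a3 V k"
        using mult_left_mono[OF ge[OF V], of \<beta>] beta by (simp add: b_def mult.assoc)
      then have "nocc V k \<le> nbar (b * V powr (- 2 * a))"
        unfolding nocc_def using ba by (intro nbar_antimono)
      also have "\<dots> \<le> 1 / (b * V powr (- 2 * a))" using ba by (rule nbar_le_inverse)
      finally have "V powr (- 2 * a1) * nocc V k \<le> V powr (- 2 * a1) * (1 / (b * V powr (- 2 * a)))"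
        by (intro mult_left_mono) auto
      also have "\<dots> = 1 / b * (V powr (- 2 * a1) / V powr (- 2 * a))" by simp
      also have "V powr (- 2 * a1) / V powr (- 2 * a) = V powr (- 2 * (a1 - a))"
        unfolding powr_diff[symmetric] by (simp add: algebra_simps)
      finally show ?thesis .
    qed
    have "((\<lambda>V. V powr (- 2 * a1) * nocc V k) \<longlongrightarrow> 0) at_top"
    proof (rule tendsto_sandwich[OF _ _ tendsto_const])
      show "\<forall>\<^sub>F V in at_top. 0 \<le> V powr (- 2 * a1) * nocc V k"
        using eventually_ge_at_top[of 1] by eventually_elim (simp add: nocc_nonneg[OF k])
      show "\<forall>\<^sub>F V in at_top. V powr (- 2 * a1) * nocc V k \<le> 1 / b * V powr (- 2 * (a1 - a))"
        using eventually_ge_at_top[of 1] by eventually_elim (rule vn)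
      show "((\<lambda>V. 1 / b * V powr (- 2 * (a1 - a))) \<longlongrightarrow> 0) at_top" using am(3) by real_asymp
    qed
    \<comment> \<open>The variance bound is rewritten through v n: with s = lam v, the term s^2 n
      equals lam^2 v (v n).\<close>
    then have lim: "((\<lambda>V. lam\<^sup>2 / 2 * (V powr (- 2 * a1) * (V powr (- 2 * a1) * nocc V k)) +
      lam\<^sup>2 / 2 * (V powr (- 2 * a1) * nocc V k)\<^sup>2) \<longlongrightarrow> lam\<^sup>2 / 2 * (0 * 0) + lam\<^sup>2 / 2 * 0\<^sup>2) at_top"
      by (intro tendsto_intros scale_to_zero)
    have "((\<lambda>V. cumul (lam * V powr (- 2 * a1)) (nocc V k)) \<longlongrightarrow> 0) at_top"
    proof (rule tendsto_sandwich[OF _ _ tendsto_const])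
      show "\<forall>\<^sub>F V in at_top. 0 \<le> cumul (lam * V powr (- 2 * a1)) (nocc V k)"
        using eventually_ge_at_top[of 1] by eventually_elim (use cumul_dom(2)[OF k] lam in auto)
      show "\<forall>\<^sub>F V in at_top. cumul (lam * V powr (- 2 * a1)) (nocc V k) \<le>
        lam\<^sup>2 / 2 * (V powr (- 2 * a1) * (V powr (- 2 * a1) * nocc V k)) + lam\<^sup>2 / 2 * (V powr (- 2 * a1) * nocc V k)\<^sup>2"
        using eventually_ge_at_top[of 1]
      proof eventually_elim
        case (elim V)
        show ?case using cumul_le[OF nocc_nonneg[OF k elim], of "lam * V powr (- 2 * a1)"] lam
          by (simp add: power2_eq_square ac_simps)
      qed
      show "((\<lambda>V. lam\<^sup>2 / 2 * (V powr (- 2 * a1) * (V powr (- 2 * a1) * nocc V k)) +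
        lam\<^sup>2 / 2 * (V powr (- 2 * a1) * nocc V k)\<^sup>2) \<longlongrightarrow> 0) at_top" using lim by simp
    qed
    moreover have "limit_term lam k = 0" unfolding limit_term_def kk prod.case using False by (rule if_not_P)
    ultimately show ?thesis by simp
  qed
qed

lemma infsum_cumul_limit:
  assumes lam: "0 < lam"
  shows "((\<lambda>V. \<Sum>\<^sub>\<infinity>k\<in>excited. cumul (lam * V powr (- 2 * a1)) (nocc V k)) \<longlongrightarrow> infsum (limit_term lam) excited) at_top"
    and "limit_term lam summable_on excited"
proof -
  have b: "\<forall>\<^sub>F V in at_top. \<forall>k\<in>excited. \<bar>cumul (lam * V powr (- 2 * a1)) (nocc V k)\<bar> \<le> lam\<^sup>2 * dominant k"
    using eventually_ge_at_top[of 1]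
  proof eventually_elim
    case (elim V)
    show ?case using cumul_dom(2,3)[OF _ elim, of _ lam] lam by auto
  qed
  note T = tendsto_infsum_dominated[where f = "\<lambda>k V. cumul (lam * V powr (- 2 * a1)) (nocc V k)",
    OF cumul_limit[OF _ lam] b summable_on_cmult_right[OF dominant_summable] trivial_limit_at_top_linorder]
  show "((\<lambda>V. \<Sum>\<^sub>\<infinity>k\<in>excited. cumul (lam * V powr (- 2 * a1)) (nocc V k)) \<longlongrightarrow> infsum (limit_term lam) excited) at_top"
    by (rule T(1))
  show "limit_term lam summable_on excited" by (rule T(2))
qed

end

section \<open>The limit of the canonical generating function\<close>

lemma e_fun_1 [simp]: "e_fun (Suc 0) = 0" by (simp add: e_fun_def)

text \<open>Excited modes are sorted by which indices differ from 1. Of the eight patterns only the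
  ground state, with no such index, is absent.\<close>

lemma infsum_excited_split:
  fixes T :: "nat \<times> nat \<times> nat \<Rightarrow> real"
  assumes T: "T summable_on excited"
  shows "infsum T excited =
    (\<Sum>\<^sub>\<infinity>m\<in>{2..}. T (m, 1, 1)) + (\<Sum>\<^sub>\<infinity>m\<in>{2..}. T (1, m, 1)) + (\<Sum>\<^sub>\<infinity>m\<in>{2..}. T (1, 1, m))
    + (\<Sum>\<^sub>\<infinity>(m1, m2)\<in>{2..} \<times> {2..}. T (m1, m2, 1)) + (\<Sum>\<^sub>\<infinity>(m1, m2)\<in>{2..} \<times> {2..}. T (m1, 1, m2))
    + (\<Sum>\<^sub>\<infinity>(m1, m2)\<in>{2..} \<times> {2..}. T (1, m1, m2))
    + (\<Sum>\<^sub>\<infinity>(m1, m2, m3)\<in>{2..} \<times> {2..} \<times> {2..}. T (m1, m2, m3))"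
proof -
  define Q where "Q b1 b2 b3 = {k \<in> modes. (fst k \<noteq> 1) = b1 \<and> (fst (snd k) \<noteq> 1) = b2 \<and> (snd (snd k) \<noteq> 1) = b3}" for b1 b2 b3
  have disj: "b1 = c1 \<and> b2 = c2 \<and> b3 = c3" if "k \<in> Q b1 b2 b3" "k \<in> Q c1 c2 c3" for k b1 b2 b3 c1 c2 c3
    using that unfolding Q_def by simp
  have sub: "Q b1 b2 b3 \<subseteq> excited" if "b1 \<or> b2 \<or> b3" for b1 b2 b3
  proof
    fix k assume "k \<in> Q b1 b2 b3"
    with that show "k \<in> excited" unfolding Q_def excited_def by (cases k) simp
  qed
  have ex: "excited = Q True False False \<union> (Q False True False \<union> (Q False False True \<union>
    (Q True True False \<union> (Q True False True \<union> (Q False True True \<union> Q True True True)))))"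
  proof (rule antisym)
    show "excited \<subseteq> Q True False False \<union> (Q False True False \<union> (Q False False True \<union>
      (Q True True False \<union> (Q True False True \<union> (Q False True True \<union> Q True True True)))))"
    proof
      fix k assume k: "k \<in> excited"
      obtain n1 n2 n3 where kk: "k = (n1, n2, n3)" by (cases k)
      have "k \<in> Q (n1 \<noteq> 1) (n2 \<noteq> 1) (n3 \<noteq> 1)" "n1 \<noteq> 1 \<or> n2 \<noteq> 1 \<or> n3 \<noteq> 1"
        using k unfolding kk Q_def excited_def by simp_all
      then show "k \<in> Q True False False \<union> (Q False True False \<union> (Q False False True \<union>
        (Q True True False \<union> (Q True False True \<union> (Q False True True \<union> Q True True True)))))"
        by (cases "n1 = 1"; cases "n2 = 1"; cases "n3 = 1") simp_all
    qed
  qed (use sub in simp)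
  have split: "infsum T (X \<union> Y) = infsum T X + infsum T Y" if "X \<subseteq> excited" "Y \<subseteq> excited" "X \<inter> Y = {}" for X Y
    by (rule infsum_Un_disjoint) (use summable_on_subset_banach[OF T] that in auto)
  have "infsum T excited = infsum T (Q True False False) + (infsum T (Q False True False) + (infsum T (Q False False True)
    + (infsum T (Q True True False) + (infsum T (Q True False True) + (infsum T (Q False True True) + infsum T (Q True True True))))))"
    unfolding ex
    apply (subst split, simp add: sub, simp add: sub, blast dest: disj)
    apply (subst split, simp add: sub, simp add: sub, blast dest: disj)
    apply (subst split, simp add: sub, simp add: sub, blast dest: disj)
    apply (subst split, simp add: sub, simp add: sub, blast dest: disj)
    apply (subst split, simp add: sub, simp add: sub, blast dest: disj)
    apply (subst split, simp add: sub, simp add: sub, blast dest: disj)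
    by (rule refl)
  moreover have "infsum T (Q True False False) = (\<Sum>\<^sub>\<infinity>m\<in>{2..}. T (m, 1, 1))"
    by (rule infsum_reindex_bij_witness[where i = "\<lambda>m. (m, 1, 1)" and j = fst]) (auto simp: Q_def modes_def)
  moreover have "infsum T (Q False True False) = (\<Sum>\<^sub>\<infinity>m\<in>{2..}. T (1, m, 1))"
    by (rule infsum_reindex_bij_witness[where i = "\<lambda>m. (1, m, 1)" and j = "\<lambda>(_, m, _). m"]) (auto simp: Q_def modes_def)
  moreover have "infsum T (Q False False True) = (\<Sum>\<^sub>\<infinity>m\<in>{2..}. T (1, 1, m))"
    by (rule infsum_reindex_bij_witness[where i = "\<lambda>m. (1, 1, m)" and j = "\<lambda>(_, _, m). m"]) (auto simp: Q_def modes_def)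
  moreover have "infsum T (Q True True False) = (\<Sum>\<^sub>\<infinity>(m1, m2)\<in>{2..} \<times> {2..}. T (m1, m2, 1))"
    by (rule infsum_reindex_bij_witness[where i = "\<lambda>(m1, m2). (m1, m2, 1)" and j = "\<lambda>(m1, m2, _). (m1, m2)"]) (auto simp: Q_def modes_def)
  moreover have "infsum T (Q True False True) = (\<Sum>\<^sub>\<infinity>(m1, m2)\<in>{2..} \<times> {2..}. T (m1, 1, m2))"
    by (rule infsum_reindex_bij_witness[where i = "\<lambda>(m1, m2). (m1, 1, m2)" and j = "\<lambda>(m1, _, m2). (m1, m2)"]) (auto simp: Q_def modes_def)
  moreover have "infsum T (Q False True True) = (\<Sum>\<^sub>\<infinity>(m1, m2)\<in>{2..} \<times> {2..}. T (1, m1, m2))"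
    by (rule infsum_reindex_bij_witness[where i = "\<lambda>(m1, m2). (1, m1, m2)" and j = "\<lambda>(_, m1, m2). (m1, m2)"]) (auto simp: Q_def modes_def)
  moreover have "infsum T (Q True True True) = (\<Sum>\<^sub>\<infinity>(m1, m2, m3)\<in>{2..} \<times> {2..} \<times> {2..}. T (m1, m2, m3))"
  proof -
    have "Q True True True = {2..} \<times> {2..} \<times> {2..}" by (auto simp: Q_def modes_def)
    then show ?thesis by simp
  qed
  ultimately show ?thesis by (simp only: add.assoc)
qed

section \<open>The three geometries and the limit of the generating function\<close>

context box begin

text \<open>With d sides of maximal length, patterns excited in any other direction vanish. The rest
  coincide by symmetry and number d choose j for j excited directions, which gives the coefficients
  1; 2, 1; 3, 3, 1.\<close>

lemma infsum_limit_term: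
  assumes lam: "0 < lam"
  shows "a3 < a2 \<Longrightarrow> a2 < a1 \<Longrightarrow> infsum (limit_term lam) excited = g1 \<beta> lam"
    and "a3 < a2 \<Longrightarrow> a2 = a1 \<Longrightarrow> infsum (limit_term lam) excited = 2 * g1 \<beta> lam + g2 \<beta> lam"
    and "a3 = a2 \<Longrightarrow> a2 = a1 \<Longrightarrow> infsum (limit_term lam) excited = 3 * g1 \<beta> lam + 3 * g2 \<beta> lam + g3 \<beta> lam"
proof -
  note sp = infsum_excited_split[OF infsum_cumul_limit(2)[OF lam]]
  have z: "infsum f A = 0" if "\<And>x. x \<in> A \<Longrightarrow> f x = 0" for f :: "'z \<Rightarrow> real" and A
    using that by (rule infsum_0)
  show "infsum (limit_term lam) excited = g1 \<beta> lam" if c: "a3 < a2" "a2 < a1"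
  proof -
    have ne: "a2 \<noteq> a1" "a3 \<noteq> a1" using c by auto
    have "(\<Sum>\<^sub>\<infinity>m\<in>{2..}. limit_term lam (1, m, 1)) = 0" "(\<Sum>\<^sub>\<infinity>m\<in>{2..}. limit_term lam (1, 1, m)) = 0"
      "(\<Sum>\<^sub>\<infinity>(m1, m2)\<in>{2..} \<times> {2..}. limit_term lam (m1, m2, 1)) = 0"
      "(\<Sum>\<^sub>\<infinity>(m1, m2)\<in>{2..} \<times> {2..}. limit_term lam (m1, 1, m2)) = 0"
      "(\<Sum>\<^sub>\<infinity>(m1, m2)\<in>{2..} \<times> {2..}. limit_term lam (1, m1, m2)) = 0"
      "(\<Sum>\<^sub>\<infinity>(m1, m2, m3)\<in>{2..} \<times> {2..} \<times> {2..}. limit_term lam (m1, m2, m3)) = 0"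
      by (intro z; auto simp: limit_term_def ne)+
    moreover have "(\<Sum>\<^sub>\<infinity>m\<in>{2..}. limit_term lam (m, 1, 1)) = g1 \<beta> lam"
      by (simp add: g1_def limit_term_def)
    ultimately show ?thesis unfolding sp by simp
  qed
  show "infsum (limit_term lam) excited = 2 * g1 \<beta> lam + g2 \<beta> lam" if c: "a3 < a2" "a2 = a1"
  proof -
    have ne: "a3 \<noteq> a1" using c by auto
    have "(\<Sum>\<^sub>\<infinity>m\<in>{2..}. limit_term lam (1, 1, m)) = 0"
      "(\<Sum>\<^sub>\<infinity>(m1, m2)\<in>{2..} \<times> {2..}. limit_term lam (m1, 1, m2)) = 0"
      "(\<Sum>\<^sub>\<infinity>(m1, m2)\<in>{2..} \<times> {2..}. limit_term lam (1, m1, m2)) = 0"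
      "(\<Sum>\<^sub>\<infinity>(m1, m2, m3)\<in>{2..} \<times> {2..} \<times> {2..}. limit_term lam (m1, m2, m3)) = 0"
      by (intro z; auto simp: limit_term_def ne)+
    moreover have "(\<Sum>\<^sub>\<infinity>m\<in>{2..}. limit_term lam (m, 1, 1)) = g1 \<beta> lam" "(\<Sum>\<^sub>\<infinity>m\<in>{2..}. limit_term lam (1, m, 1)) = g1 \<beta> lam"
      "(\<Sum>\<^sub>\<infinity>(m1, m2)\<in>{2..} \<times> {2..}. limit_term lam (m1, m2, 1)) = g2 \<beta> lam"
      unfolding limit_term_def g1_def g2_def using c by simp_all
    ultimately show ?thesis unfolding sp by simp
  qed
  show "infsum (limit_term lam) excited = 3 * g1 \<beta> lam + 3 * g2 \<beta> lam + g3 \<beta> lam" if c: "a3 = a2" "a2 = a1"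
    unfolding sp limit_term_def g1_def g2_def g3_def using c by simp
qed

text \<open>The law of independent geometric occupations, tilted by r times the rescaled deviation
  Y. The exponent is bounded by a pure multiple of r^2, as \<open>centred_of_mgf\<close> demands,
  with a constant free of V.\<close>

lemma laplace:
  assumes V: "1 \<le> V"
  defines "P \<equiv> \<lambda>c. weight (\<lambda>k. exp (- \<beta> * gap a1 a2 a3 V k)) c /
      exp (\<Sum>\<^sub>\<infinity>k\<in>excited. - ln (1 - exp (- \<beta> * gap a1 a2 a3 V k)))"
    and "Y \<equiv> \<lambda>c. V powr (- 2 * a1) * (real (particles c) - infsum (nocc V) excited)"
  assumes r: "0 \<le> r \<or> \<bar>r\<bar> \<le> r0"
  shows "((\<lambda>c. P c * exp (- r * Y c)) has_sum
      exp (\<Sum>\<^sub>\<infinity>k\<in>excited. cumul (r * V powr (- 2 * a1)) (nocc V k))) (fin_supp excited)"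
    and "(\<Sum>\<^sub>\<infinity>k\<in>excited. cumul (r * V powr (- 2 * a1)) (nocc V k)) \<le> infsum dominant excited * r\<^sup>2"
proof -
  let ?s = "r * V powr (- 2 * a1)"
  have q: "0 < exp (- \<beta> * gap a1 a2 a3 V k) \<and> exp (- \<beta> * gap a1 a2 a3 V k) < 1" if "k \<in> excited" for k
    using gap_pos[OF that V] by simp
  have n: "nocc V k = exp (- \<beta> * gap a1 a2 a3 V k) / (1 - exp (- \<beta> * gap a1 a2 a3 V k))" if "k \<in> excited" for k
    using gap_pos[OF that V] by (simp add: nocc_def nbar_def exp_minus field_simps)
  have sc: "(\<lambda>k. cumul ?s (nocc V k)) summable_on excited"
    by (rule summable_on_comparison_test[OF summable_on_cmult_right[OF dominant_summable]])
      (use cumul_dom(2,3)[OF _ V r] in auto)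
  have "((\<lambda>c. P c * exp (- ?s * (real (particles c) - infsum (nocc V) excited))) has_sum
      exp (\<Sum>\<^sub>\<infinity>k\<in>excited. cumul ?s (nocc V k))) (fin_supp excited)"
    unfolding P_def
    by (rule weight_laplace[OF q n nocc_summable[OF V] cumul_dom(1)[OF _ V r] sc])
  then show "((\<lambda>c. P c * exp (- r * Y c)) has_sum
      exp (\<Sum>\<^sub>\<infinity>k\<in>excited. cumul ?s (nocc V k))) (fin_supp excited)"
    by (simp add: Y_def mult.assoc)
  have "(\<Sum>\<^sub>\<infinity>k\<in>excited. cumul ?s (nocc V k)) \<le> (\<Sum>\<^sub>\<infinity>k\<in>excited. r\<^sup>2 * dominant k)"
    by (rule infsum_mono[OF sc summable_on_cmult_right[OF dominant_summable]]) (rule cumul_dom(3)[OF _ V r])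
  also have "\<dots> = infsum dominant excited * r\<^sup>2" unfolding infsum_cmult_right' by (rule mult.commute)
  finally show "(\<Sum>\<^sub>\<infinity>k\<in>excited. cumul ?s (nocc V k)) \<le> infsum dominant excited * r\<^sup>2" .
qed

text \<open>The second-moment bound that \<open>centred_of_mgf\<close> yields for Y; it does not
  depend on V.\<close>

definition S_bound :: real where "S_bound = 4 * exp (infsum dominant excited * r0\<^sup>2) / r0\<^sup>2"

text \<open>\<open>p\<close>, \<open>\<mu>\<close> and \<open>G\<close> are the probability, the mean of the centred rescaled number of excited particles and
  its Laplace transform, all restricted to the event that this number does not exceed \<open>N\<close>.\<close>

lemma canon_exp_conditioned:
  assumes V: "1 \<le> V" and lam: "0 < lam" and y: "0 < y"
    and tail: "y \<le> V powr (- 2 * a1) * (real N - infsum (nocc V) excited)"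
    and small: "S_bound / y\<^sup>2 < 1"
  shows "\<exists>p \<mu> G. \<bar>p - 1\<bar> \<le> S_bound / y\<^sup>2 \<and> \<bar>\<mu>\<bar> \<le> S_bound / y \<and>
     \<bar>G - exp (\<Sum>\<^sub>\<infinity>k\<in>excited. cumul (lam * V powr (- 2 * a1)) (nocc V k))\<bar> \<le> S_bound / y\<^sup>2 \<and>
     canon_exp \<beta> a1 a2 a3 V N (\<lambda>c. exp (lam * V powr (1 - 2 * a1) *
          (real (occ_ground c) / V - canon_exp \<beta> a1 a2 a3 V N (\<lambda>c'. real (occ_ground c') / V)))) =
     exp (lam * (\<mu> / p)) * G / p"
proof -
  let ?v = "V powr (- 2 * a1)" and ?C = "fin_supp excited" and ?m = "infsum (nocc V) excited"
  let ?q = "\<lambda>k. exp (- \<beta> * gap a1 a2 a3 V k)"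
  define Z where "Z = exp (\<Sum>\<^sub>\<infinity>k\<in>excited. - ln (1 - ?q k))"
  define P where "P c = weight ?q c / Z" for c
  define Y where "Y c = ?v * (real (particles c) - ?m)" for c :: "nat \<times> nat \<times> nat \<Rightarrow> nat"
  define A where "A = {c \<in> ?C. particles c \<le> N}"
  have v: "0 < ?v" using V by simp
  have Z: "0 < Z" by (simp add: Z_def)
  have P0: "0 \<le> P c" if "c \<in> ?C" for c
    using weight_nonneg[OF _ that, of ?q] Z by (simp add: P_def)
  have lap: "((\<lambda>c. P c * exp (- r * Y c)) has_sum
      exp (\<Sum>\<^sub>\<infinity>k\<in>excited. cumul (r * ?v) (nocc V k))) ?C"
    and bd: "(\<Sum>\<^sub>\<infinity>k\<in>excited. cumul (r * ?v) (nocc V k)) \<le> infsum dominant excited * r\<^sup>2"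
    if "0 \<le> r \<or> \<bar>r\<bar> \<le> r0" for r
    using laplace[OF V that] unfolding P_def Y_def Z_def by auto
  \<comment> \<open>At r = 0 every cumulant vanishes, so the transform reduces to the normalisation
    of P.\<close>
  have P1: "(P has_sum 1) ?C" using lap[of 0] by (simp add: cumul_def)
  have B0: "0 \<le> infsum dominant excited" by (rule infsum_nonneg) (simp add: dominant_def)
  note cen = centred_of_mgf[where P = P and Y = Y and C = ?C and B = "infsum dominant excited" and ?r0.0 = r0
      and G = "\<lambda>r. exp (\<Sum>\<^sub>\<infinity>k\<in>excited. cumul (r * ?v) (nocc V k))",
      OF P0 lap[OF disjI2] P1 iffD2[OF exp_le_cancel_iff bd[OF disjI2]] r0_pos B0, folded S_bound_def]
  have tl: "y \<le> Y c" if "c \<in> ?C" "c \<notin> A" for c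
  proof -
    have "real N \<le> real (particles c)" using that by (simp add: A_def)
    then have "?v * (real N - ?m) \<le> Y c" unfolding Y_def using v by (intro mult_left_mono) auto
    then show ?thesis using tail by simp
  qed
  have AC: "A \<subseteq> ?C" by (auto simp: A_def)
  note cb = conditioned_bounds[OF P0 P1 cen(1) cen(2) cen(3) lap[OF disjI1[OF less_imp_le[OF lam]]] less_imp_le[OF lam] AC tl y]
  define p where "p = infsum P A"
  define \<mu> where "\<mu> = (\<Sum>\<^sub>\<infinity>c\<in>A. P c * Y c)"
  define G where "G = (\<Sum>\<^sub>\<infinity>c\<in>A. P c * exp (- lam * Y c))"
  have b: "\<bar>p - 1\<bar> \<le> S_bound / y\<^sup>2" "\<bar>\<mu>\<bar> \<le> S_bound / y"
    "\<bar>G - exp (\<Sum>\<^sub>\<infinity>k\<in>excited. cumul (lam * ?v) (nocc V k))\<bar> \<le> S_bound / y\<^sup>2"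
    using cb unfolding p_def \<mu>_def G_def by auto
  have p: "0 < p" using b(1) small by linarith
  have sA: "P summable_on A" "(\<lambda>c. P c * Y c) summable_on A"
    using summable_on_subset_banach[OF has_sum_imp_summable AC] P1 cen(1) by blast+
  have VV: "?v * V = V powr (1 - 2 * a1)" using V powr_add[of V "- 2 * a1" 1] by (simp add: add.commute)
  let ?E = "canon_exp \<beta> a1 a2 a3 V N"
  \<comment> \<open>On A the subtraction in nat does not truncate, so the ground-state occupation is
    affine in Y.\<close>
  have occ_eq: "real (N - particles c) = real N - ?m - Y c / ?v" if "c \<in> A" for c
    using that v by (simp add: A_def Y_def of_nat_diff)
  have mean: "?E (\<lambda>c. real (occ_ground c) / V) = (real N - ?m) / V - \<mu> / (?v * V * p)"
  proof -
    have "?E (\<lambda>c. real (occ_ground c) / V) = (\<Sum>\<^sub>\<infinity>c\<in>A. real (N - particles c) / V * P c) / p"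
      using canon_exp_eq[of Z \<beta> a1 a2 a3 V N "\<lambda>n. real n / V"] Z
      unfolding P_def A_def p_def by simp
    also have "(\<Sum>\<^sub>\<infinity>c\<in>A. real (N - particles c) / V * P c) =
      (\<Sum>\<^sub>\<infinity>c\<in>A. (real N - ?m) / V * P c + (- 1 / (?v * V)) * (P c * Y c))"
      by (rule infsum_cong) (use v V in \<open>simp add: occ_eq field_simps\<close>)
    also have "\<dots> = (real N - ?m) / V * p + (- 1 / (?v * V)) * \<mu>"
      unfolding p_def \<mu>_def infsum_add[OF summable_on_cmult_right[OF sA(1)] summable_on_cmult_right[OF sA(2)]]
        infsum_cmult_right' ..
    also have "\<dots> / p = (real N - ?m) / V - \<mu> / (?v * V * p)"
      using p by (simp add: add_divide_distrib diff_divide_distrib)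
    finally show ?thesis .
  qed
  let ?M = "?E (\<lambda>c. real (occ_ground c) / V)"
  have "?E (\<lambda>c. exp (lam * V powr (1 - 2 * a1) * (real (occ_ground c) / V - ?M))) =
    (\<Sum>\<^sub>\<infinity>c\<in>A. exp (lam * V powr (1 - 2 * a1) * (real (N - particles c) / V - ?M)) * P c) / p"
    using canon_exp_eq[of Z \<beta> a1 a2 a3 V N "\<lambda>n. exp (lam * V powr (1 - 2 * a1) * (real n / V - ?M))"] Z
    unfolding P_def A_def p_def by simp
  also have "(\<Sum>\<^sub>\<infinity>c\<in>A. exp (lam * V powr (1 - 2 * a1) * (real (N - particles c) / V - ?M)) * P c) =
    (\<Sum>\<^sub>\<infinity>c\<in>A. exp (lam * (\<mu> / p)) * (P c * exp (- lam * Y c)))"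
  proof (rule infsum_cong)
    fix c assume c: "c \<in> A"
    \<comment> \<open>The deterministic part of the occupation cancels against the mean, and v V = V
      powr (1 - 2 a1) removes the scale: only the deviation of Y from its conditional mean \<mu> / p
      remains.\<close>
    have "lam * V powr (1 - 2 * a1) * (real (N - particles c) / V - ?M) = lam * (?v * V * (\<mu> / (?v * V * p) - Y c / ?v / V))"
      unfolding mean occ_eq[OF c] VV[symmetric] by (simp add: diff_divide_distrib)
    also have "?v * V * (\<mu> / (?v * V * p) - Y c / ?v / V) = \<mu> / p - Y c"
      using v V by (simp add: right_diff_distrib)
    finally have "exp (lam * V powr (1 - 2 * a1) * (real (N - particles c) / V - ?M)) = exp (lam * (\<mu> / p - Y c))"
      by (rule arg_cong)
    also have "exp (lam * (\<mu> / p - Y c)) = exp (lam * (\<mu> / p)) * exp (- lam * Y c)"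
      by (simp add: right_diff_distrib flip: exp_add)
    finally show "exp (lam * V powr (1 - 2 * a1) * (real (N - particles c) / V - ?M)) * P c =
      exp (lam * (\<mu> / p)) * (P c * exp (- lam * Y c))"
      by (simp only: ac_simps)
  qed
  also have "\<dots> = exp (lam * (\<mu> / p)) * G" unfolding G_def by (rule infsum_cmult_right')
  finally show ?thesis using b by blast
qed

text \<open>Above the critical density the rescaled threshold N recedes to infinity, so p tends to
  1, \<mu> to 0, and the restricted transform G has the same limit as the unrestricted one.\<close>

lemma canon_limit:
  assumes lam: "0 < lam" and rho: "rho_c \<beta> < \<rho>"
  shows "(\<lambda>N. canon_exp \<beta> a1 a2 a3 (real N / \<rho>) N (\<lambda>c. exp (lam * (real N / \<rho>) powr (1 - 2 * a1) *
          (real (occ_ground c) / (real N / \<rho>) -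
           canon_exp \<beta> a1 a2 a3 (real N / \<rho>) N (\<lambda>c'. real (occ_ground c') / (real N / \<rho>))))))
    \<longlonglongrightarrow> exp (infsum (limit_term lam) excited)" (is "?L \<longlonglongrightarrow> _")
proof -
  have rho0: "0 < \<rho>" using nn_integral_occ_eq_rho_c(2)[OF beta] rho by simp
  define V where "V N = real N / \<rho>" for N
  have Vtop: "filterlim V at_top sequentially" unfolding V_def using rho0 by real_asymp
  obtain C p where C: "0 \<le> C" "2 * a1 * p < 1"
    "\<And>V. 1 \<le> V \<Longrightarrow> infsum (nocc V) excited \<le> V * rho_c \<beta> + C * V powr (2 * a1 * p)"
    by (rule infsum_nocc_le) (rule that)
  \<comment> \<open>A lower bound for the rescaled distance between N and the mean number of excited
    particles: the density excess dominates because 2 a1 p < 1.\<close>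
  define y where "y N = V N powr (1 - 2 * a1) * ((\<rho> - rho_c \<beta>) - C * V N powr (2 * a1 * p - 1))" for N
  have ytop: "filterlim y at_top sequentially"
  proof -
    have "filterlim (\<lambda>V. V powr (1 - 2 * a1)) at_top at_top" using half by real_asymp
    moreover have "((\<lambda>V. V powr (2 * a1 * p - 1)) \<longlongrightarrow> 0) at_top" using C(2) by real_asymp
    then have "((\<lambda>V. (\<rho> - rho_c \<beta>) - C * V powr (2 * a1 * p - 1)) \<longlongrightarrow> (\<rho> - rho_c \<beta>) - C * 0) at_top"
      by (intro tendsto_intros)
    ultimately have "filterlim (\<lambda>V. ((\<rho> - rho_c \<beta>) - C * V powr (2 * a1 * p - 1)) * V powr (1 - 2 * a1)) at_top at_top"
      using rho by (intro filterlim_tendsto_pos_mult_at_top) auto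
    from filterlim_compose[OF this Vtop] show ?thesis by (simp add: y_def[abs_def] mult.commute)
  qed
  let ?S = S_bound
  have S2: "(\<lambda>N. ?S / (y N)\<^sup>2) \<longlonglongrightarrow> 0"
    by (intro real_tendsto_divide_at_top[OF tendsto_const] filterlim_pow_at_top ytop) simp
  have S1: "(\<lambda>N. ?S / y N) \<longlonglongrightarrow> 0"
    by (intro real_tendsto_divide_at_top[OF tendsto_const] ytop)
  let ?Q = "\<lambda>N p \<mu> G. \<bar>p - 1\<bar> \<le> ?S / (y N)\<^sup>2 \<and> \<bar>\<mu>\<bar> \<le> ?S / y N \<and>
     \<bar>G - exp (\<Sum>\<^sub>\<infinity>k\<in>excited. cumul (lam * V N powr (- 2 * a1)) (nocc (V N) k))\<bar> \<le> ?S / (y N)\<^sup>2 \<and>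
     ?L N = exp (lam * (\<mu> / p)) * G / p"
  have ev: "\<forall>\<^sub>F N in sequentially. \<exists>p \<mu> G. ?Q N p \<mu> G"
  proof -
    have "\<forall>\<^sub>F N in sequentially. 1 \<le> V N" using Vtop by (simp add: filterlim_at_top)
    moreover have "\<forall>\<^sub>F N in sequentially. 0 < y N" using ytop by (simp add: filterlim_at_top_dense)
    moreover have "\<forall>\<^sub>F N in sequentially. ?S / (y N)\<^sup>2 < 1" using order_tendstoD(2)[OF S2, of 1] by simp
    ultimately show ?thesis
    proof eventually_elim
      case (elim N)
      have N: "real N = \<rho> * V N" using rho0 by (simp add: V_def)
      have "V N powr (- 2 * a1) * (V N * (\<rho> - rho_c \<beta>) - C * V N powr (2 * a1 * p)) = y N"
      proof -
        have 1: "V N powr (- 2 * a1) * V N = V N powr (1 - 2 * a1)"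
          using elim(1) powr_add[of "V N" "- 2 * a1" 1] by (simp add: add.commute)
        have 2: "V N powr (- 2 * a1) * V N powr (2 * a1 * p) = V N powr (1 - 2 * a1) * V N powr (2 * a1 * p - 1)"
          by (simp flip: powr_add)
        have "V N powr (- 2 * a1) * (V N * (\<rho> - rho_c \<beta>) - C * V N powr (2 * a1 * p)) =
          V N powr (- 2 * a1) * V N * (\<rho> - rho_c \<beta>) - C * (V N powr (- 2 * a1) * V N powr (2 * a1 * p))"
          by (simp only: right_diff_distrib mult.assoc mult.left_commute)
        also have "\<dots> = y N" unfolding 1 2 y_def by (simp only: right_diff_distrib mult.left_commute)
        finally show ?thesis .
      qed
      moreover have "V N powr (- 2 * a1) * (V N * (\<rho> - rho_c \<beta>) - C * V N powr (2 * a1 * p)) \<le>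
        V N powr (- 2 * a1) * (real N - infsum (nocc (V N)) excited)"
        using C(3)[OF elim(1)] unfolding N by (intro mult_left_mono) (auto simp: algebra_simps)
      ultimately have "y N \<le> V N powr (- 2 * a1) * (real N - infsum (nocc (V N)) excited)" by simp
      from canon_exp_conditioned[OF elim(1) lam elim(2) this elim(3)]
      show ?case by (simp only: V_def)
    qed
  qed
  \<comment> \<open>The witnesses are chosen for each N so that their limits can be taken as limits
    of sequences.\<close>
  define W where "W N = (SOME t. case t of (p, \<mu>, G) \<Rightarrow> ?Q N p \<mu> G)" for N
  have W: "\<forall>\<^sub>F N in sequentially. ?Q N (fst (W N)) (fst (snd (W N))) (snd (snd (W N)))"
    using ev
  proof eventually_elim
    case (elim N)
    then have "\<exists>t. case t of (p, \<mu>, G) \<Rightarrow> ?Q N p \<mu> G" by auto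
    then have "case W N of (p, \<mu>, G) \<Rightarrow> ?Q N p \<mu> G" unfolding W_def by (rule someI_ex)
    then show ?case by (simp add: case_prod_beta)
  qed
  let ?p = "\<lambda>N. fst (W N)" and ?\<mu> = "\<lambda>N. fst (snd (W N))" and ?G = "\<lambda>N. snd (snd (W N))"
  let ?c = "\<lambda>N. exp (\<Sum>\<^sub>\<infinity>k\<in>excited. cumul (lam * V N powr (- 2 * a1)) (nocc (V N) k))"
  have p1: "?p \<longlonglongrightarrow> 1"
    by (rule LIM_zero_cancel, rule Lim_null_comparison[OF _ S2]) (use W in \<open>auto elim: eventually_mono\<close>)
  have m0: "?\<mu> \<longlonglongrightarrow> 0"
    by (rule Lim_null_comparison[OF _ S1]) (use W in \<open>auto elim: eventually_mono\<close>)
  have Gc: "(\<lambda>N. ?G N - ?c N) \<longlonglongrightarrow> 0"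
    by (rule Lim_null_comparison[OF _ S2]) (use W in \<open>auto elim: eventually_mono\<close>)
  have cl: "?c \<longlonglongrightarrow> exp (infsum (limit_term lam) excited)"
    by (intro tendsto_exp filterlim_compose[OF infsum_cumul_limit(1)[OF lam] Vtop])
  have Gl: "?G \<longlonglongrightarrow> exp (infsum (limit_term lam) excited)"
    using tendsto_add[OF Gc cl] by simp
  have "(\<lambda>N. exp (lam * (?\<mu> N / ?p N)) * ?G N / ?p N) \<longlonglongrightarrow> exp (lam * (0 / 1)) * exp (infsum (limit_term lam) excited) / 1"
    by (intro tendsto_intros m0 p1 Gl) auto
  moreover have "\<forall>\<^sub>F N in sequentially. exp (lam * (?\<mu> N / ?p N)) * ?G N / ?p N = ?L N"
    using W by (auto elim: eventually_mono)
  ultimately show ?thesis by (simp add: tendsto_cong)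
qed

end

theorem theorem3p15:
  fixes a1 a2 a3 \<beta> \<rho> lam :: real
  assumes ord: "a1 \<ge> a2" "a2 \<ge> a3" "a3 > 0"
    and sum1: "a1 + a2 + a3 = 1"
    and half: "a1 < 1/2"
    and beta: "\<beta> > 0"
    and rho: "\<rho> > rho_c \<beta>"
    and lam: "lam > 0"
  defines "\<gamma> \<equiv> 1 - 2 * a1"
  defines "L \<equiv> (\<lambda>N::nat. let V = real N / \<rho> in
      canon_exp \<beta> a1 a2 a3 V N (\<lambda>c. exp (lam * V powr \<gamma> *
          (real (occ_ground c) / V
           - canon_exp \<beta> a1 a2 a3 V N (\<lambda>c'. real (occ_ground c') / V)))))"
  shows "(a3 < a2 \<and> a2 < a1 \<longrightarrow> L \<longlonglongrightarrow> exp (g1 \<beta> lam))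
       \<and> (a3 < a2 \<and> a2 = a1 \<longrightarrow> L \<longlonglongrightarrow> exp (2 * g1 \<beta> lam + g2 \<beta> lam))
       \<and> (a3 = a2 \<and> a2 = a1 \<and> a1 = 1/3 \<longrightarrow>
            L \<longlonglongrightarrow> exp (3 * g1 \<beta> lam + 3 * g2 \<beta> lam + g3 \<beta> lam))"
proof -
  interpret box a1 a2 a3 \<beta> by unfold_locales (fact ord sum1 half beta)+
  have "L \<longlonglongrightarrow> exp (infsum (limit_term lam) excited)"
    using canon_limit[OF lam rho] unfolding L_def \<gamma>_def Let_def .
  then show ?thesis using infsum_limit_term[OF lam] by auto
qed

end
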